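(* Let $p\in(1,2]$ and let $p'$ be defined by $1/p+1/p'=1$. Let $X$ be a $(p,C_{\mathrm{sm}})$-smooth Banach space with norm $|\cdot|$, let $(\Omega,(\mathcal{F}_n)_{n\in\mathbb{N}})$ be a filtered probability space, and let $(g_n)_{n\in\mathbb{N}}$, $(f_n)_{n\in\mathbb{N}}$, $(\tilde f_n)_{n\in\mathbb{N}}$ be adapted processes with values in $X$. Assume that $f_0=\tilde f_0=0$ and that, for every $n\in\mathbb{N}_{>0}$, $$f_n=\tilde f_{n-1}+(g_n-g_{n-1}),\qquad |\tilde f_n|\le|f_n|.$$ Then, for every measurable function (weight) $w:\Omega\to\mathbb{R}_{\ge0}$, $$\mathbb{E}(f^{*}w)\le 84\,p'\,C_{\mathrm{sm}}\,\mathbb{E}(S_p g\cdot w^{*}),$$ and this implies, for every $r\in[1,\infty)$, $$\|f^{*}\|_{L^r}\le 84\,p'\,C_{\mathrm{sm}}\,r\,\|S_p g\|_{L^r}.$$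
   Context: For $p\in[1,2]$ and $C_{\mathrm{sm}}\in\mathbb{R}_{>0}$, a Banach space $(X,|\cdot|)$ is called $(p,C_{\mathrm{sm}})$-smooth if for all $x,y\in X$, $$\tfrac12\bigl(|x+y|^p+|x-y|^p\bigr)\le |x|^p+C_{\mathrm{sm}}^p|y|^p.$$ Notation: $\mathbb{N}=\{0,1,2,\dots\}$, $S_p g=\bigl(|g_0|^p+\sum_{n=1}^\infty|g_n-g_{n-1}|^p\bigr)^{1/p}$, $f^{*}=\sup_{n\in\mathbb{N}}|f_n|$, $w^{*}=\sup_{n\in\mathbb{N}}\mathbb{E}(w\mid\mathcal{F}_n)$, and $L^r=L^r(\Omega)$.
   Formalization: The process (g_n) is additionally assumed to be a (Bochner integrable) martingale with respect to (F_n); for merely adapted g the claim is false, e.g. for deterministic g_n = f_n = f̃_n = min(n,N) in X = ℝ, p = 2, w = 1, N large. *)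

theory Defs
  imports "HOL-Probability.Probability"
begin

definition smooth_banach :: "'x::banach itself \<Rightarrow> real \<Rightarrow> real \<Rightarrow> bool" where
  "smooth_banach _ p C \<longleftrightarrow> 1 \<le> p \<and> p \<le> 2 \<and> 0 < C \<and>
     (\<forall>x y :: 'x. (norm (x + y) powr p + norm (x - y) powr p) / 2
                    \<le> norm x powr p + C powr p * norm y powr p)"

text \<open>
  The Bochner integral of HOL-Analysis is restricted to second countable (i.e. separable) Banach
  spaces. The following notions make no separability assumption; the lemmas after them show that
  they agree with the library's in the separable case.
\<close>

definition strongly_measurable :: "'w measure \<Rightarrow> ('w \<Rightarrow> 'x::real_normed_vector) \<Rightarrow> bool" where
  "strongly_measurable M h \<longleftrightarrow>
     (\<exists>s. (\<forall>i. simple_function M (s i)) \<and> (\<forall>\<omega>\<in>space M. (\<lambda>i::nat. s i \<omega>) \<longlonglongrightarrow> h \<omega>))"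

definition has_strong_integral ::
    "'w measure \<Rightarrow> ('w \<Rightarrow> 'x::real_normed_vector) \<Rightarrow> 'x \<Rightarrow> bool" where
  "has_strong_integral M h I \<longleftrightarrow> strongly_measurable M h \<and>
     (\<exists>s. (\<forall>i. Bochner_Integration.simple_bochner_integrable M (s i)) \<and>
          (\<lambda>i::nat. \<integral>\<^sup>+\<omega>. ennreal (norm (h \<omega> - s i \<omega>)) \<partial>M) \<longlonglongrightarrow> 0 \<and>
          (\<lambda>i. Bochner_Integration.simple_bochner_integral M (s i)) \<longlonglongrightarrow> I)"

lemma strongly_measurable_iff_borel:
  fixes h :: "'w \<Rightarrow> 'x::{real_normed_vector, second_countable_topology}"
  shows "strongly_measurable M h \<longleftrightarrow> h \<in> borel_measurable M"
proof
  assume "strongly_measurable M h"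
  then obtain s where s: "\<forall>i. simple_function M (s i)"
    "\<forall>\<omega>\<in>space M. (\<lambda>i::nat. s i \<omega>) \<longlonglongrightarrow> h \<omega>"
    unfolding strongly_measurable_def by (elim exE conjE)
  show "h \<in> borel_measurable M"
  proof (rule borel_measurable_LIMSEQ_metric)
    show "s i \<in> borel_measurable M" for i
      by (rule borel_measurable_simple_function[OF s(1)[rule_format]])
    show "(\<lambda>i. s i \<omega>) \<longlonglongrightarrow> h \<omega>" if "\<omega> \<in> space M" for \<omega>
      by (rule s(2)[rule_format, OF that])
  qed
next
  assume "h \<in> borel_measurable M"
  from borel_measurable_implies_sequence_metric[OF this, of 0]
  obtain s where s: "\<forall>i. simple_function M (s i)"
    "\<forall>\<omega>\<in>space M. (\<lambda>i::nat. s i \<omega>) \<longlonglongrightarrow> h \<omega>"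
    by (elim exE conjE)
  show "strongly_measurable M h"
    unfolding strongly_measurable_def by (rule exI[of _ s], rule conjI[OF s])
qed

lemma has_strong_integral_iff_has_bochner_integral:
  fixes h :: "'w \<Rightarrow> 'x::{real_normed_vector, second_countable_topology}"
  shows "has_strong_integral M h I \<longleftrightarrow> has_bochner_integral M h I"
proof
  assume "has_strong_integral M h I"
  then obtain s where "h \<in> borel_measurable M"
    "\<forall>i. Bochner_Integration.simple_bochner_integrable M (s i)"
    "(\<lambda>i::nat. \<integral>\<^sup>+\<omega>. ennreal (norm (h \<omega> - s i \<omega>)) \<partial>M) \<longlonglongrightarrow> 0"
    "(\<lambda>i. Bochner_Integration.simple_bochner_integral M (s i)) \<longlonglongrightarrow> I"
    unfolding has_strong_integral_def strongly_measurable_iff_borel by (elim exE conjE)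
  then show "has_bochner_integral M h I"
    by (intro has_bochner_integral.intros[of h M s I]) simp_all
next
  assume "has_bochner_integral M h I"
  then show "has_strong_integral M h I"
    unfolding has_strong_integral_def strongly_measurable_iff_borel
    by cases (intro conjI exI allI, assumption+)
qed

definition adapted :: "(nat \<Rightarrow> 'w measure) \<Rightarrow> (nat \<Rightarrow> 'w \<Rightarrow> 'x::real_normed_vector) \<Rightarrow> bool" where
  "adapted F h \<longleftrightarrow> (\<forall>n. strongly_measurable (F n) (h n))"

text \<open>
  A martingale is an adapted process of Bochner integrable functions with
  \<open>E (h n | F m) = h m\<close> for \<open>m \<le> n\<close>. As conditional expectations are only available for
  scalar functions, this is spelled out by their defining property: \<open>h m\<close> and \<open>h n\<close> have
  the same integral over every event of \<open>F m\<close>. Integrability is the case \<open>A = space M\<close>.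
\<close>

definition banach_martingale ::
    "'w measure \<Rightarrow> (nat \<Rightarrow> 'w measure) \<Rightarrow> (nat \<Rightarrow> 'w \<Rightarrow> 'x::banach) \<Rightarrow> bool" where
  "banach_martingale M F h \<longleftrightarrow> adapted F h \<and>
     (\<forall>m n. \<forall>A\<in>sets (F m). m \<le> n \<longrightarrow>
        (\<exists>I. has_strong_integral M (\<lambda>\<omega>. indicator A \<omega> *\<^sub>R h m \<omega>) I \<and>
             has_strong_integral M (\<lambda>\<omega>. indicator A \<omega> *\<^sub>R h n \<omega>) I))"

text \<open>Powers on \<open>[0, \<infinity>]\<close> with exponent \<open>a > 0\<close>.\<close>

definition enn_power :: "ennreal \<Rightarrow> real \<Rightarrow> ennreal" where
  "enn_power x a = (if x = \<infinity> then \<infinity> else ennreal (enn2real x powr a))"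

definition L_norm :: "'w measure \<Rightarrow> real \<Rightarrow> ('w \<Rightarrow> ennreal) \<Rightarrow> ennreal" where
  "L_norm M r h = enn_power (\<integral>\<^sup>+\<omega>. enn_power (h \<omega>) r \<partial>M) (1 / r)"

definition S_fun :: "real \<Rightarrow> (nat \<Rightarrow> 'w \<Rightarrow> 'x::real_normed_vector) \<Rightarrow> 'w \<Rightarrow> ennreal" where
  "S_fun p g \<omega> = enn_power
     (ennreal (norm (g 0 \<omega>) powr p) + (\<Sum>n. ennreal (norm (g (Suc n) \<omega> - g n \<omega>) powr p)))
     (1 / p)"

definition max_fun :: "(nat \<Rightarrow> 'w \<Rightarrow> 'x::real_normed_vector) \<Rightarrow> 'w \<Rightarrow> ennreal" where
  "max_fun f \<omega> = (SUP n. ennreal (norm (f n \<omega>)))"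

definition weight_max :: "'w measure \<Rightarrow> (nat \<Rightarrow> 'w measure) \<Rightarrow> ('w \<Rightarrow> real) \<Rightarrow> 'w \<Rightarrow> ennreal" where
  "weight_max M F w \<omega> = (SUP n. nn_cond_exp M (F n) (\<lambda>\<omega>'. ennreal (w \<omega>')) \<omega>)"

end

theory Submission
  imports Defs
begin

text \<open>
  The proof is by a Bellman function, that is, an explicit potential whose weighted expectation hardly
  increases along the process.

  Write \<open>s\<^sub>n\<close> for the square function up to time \<open>n\<close>, \<open>y\<^sub>n = max (f\<^sub>n\<^sup>*) (C s\<^sub>n)\<close>, and let
  \<open>U(t, y) = k (t^p + y^p)^(1/p) - (k - 1) y\<close> with \<open>k = 2 p'\<close>. Then \<open>U(|f\<^sub>n|, y\<^sub>n) \<ge> y\<^sub>n \<ge> f\<^sub>n\<^sup>*\<close>. The potential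
  does not increase when \<open>y\<close> is raised to a new record of \<open>|f|\<close> (\<open>max_potential_diagonal\<close>), and in the
  variable \<open>f\<close> it is convex and inherits the smoothness of \<open>X\<close>, with an error that is bounded by the
  increment of \<open>C s\<^sub>n\<close> (\<open>pnorm_smooth\<close>). Comparing the values at \<open>f' + d\<close> and \<open>f' - d\<close>, where the martingale
  difference \<open>d\<close> makes the latter at least as large on average as the value at \<open>f'\<close>
  (\<open>integral_norm_shift_nonneg\<close>), shows that without a weight the expectation of the potential
  increases by at most a constant times that of \<open>C s\<^sub>n\<close>. The contraction from \<open>f\<close> to \<open>f'\<close> decreases the
  potential.

  With the weight \<open>w\<^sub>n = E(w | F\<^sub>n)\<close> there is one more term, since \<open>w\<close> and \<open>f\<close> move simultaneously. As the
  potential is \<open>k\<close>-Lipschitz in \<open>f\<close>, this term is at most \<open>k |d| |\<Delta>w|\<close>, and \<open>cross_variation_le\<close>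
  bounds the expected sum of \<open>|d| |\<Delta>w|\<close> by \<open>11/2\<close> times that of \<open>s w\<^sup>*\<close>, by means of a second potential that
  is built on \<open>sqrt (w\<^sup>2 + (w\<^sup>*)\<^sup>2)\<close>. Altogether the weighted inequality holds with the constant
  \<open>16 p' C \<le> 84 p' C\<close> (\<open>weighted_maximal_finite\<close> for a bounded weight and finitely many times,
  \<open>weighted_maximal_inequality\<close> in general).

  The \<open>L\<^sup>r\<close> bound follows by duality, from the weight \<open>(f\<^sup>*)^(r - 1)\<close> and Doob's maximal inequality, whose
  constant for the exponent dual to \<open>r\<close> is \<open>r\<close>.
\<close>

section \<open>The planar p-norm and the potential\<close>

lemma conjugate_exponent_gt_1:
  fixes p p' :: real
  assumes "1 < p" "1 / p + 1 / p' = 1"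
  shows "1 < p'"
  using assms
  by (smt (verit) divide_less_eq_1_pos divide_nonpos_pos divide_le_0_1_iff le_divide_eq_1_pos)

text \<open>The function \<open>|(t, y)|\<^sub>p\<close> on the quarter plane. Kept binary because the square function is built up
  by it one increment at a time, and because the potential below couples \<open>|f\<^sub>n|\<close> to one other number.\<close>

definition pnorm :: "real \<Rightarrow> real \<Rightarrow> real \<Rightarrow> real" where
  "pnorm p t y = (t powr p + y powr p) powr (1 / p)"

lemma pnorm_nonneg [simp]: "0 \<le> pnorm p t y"
  by (simp add: pnorm_def)

lemma pnorm_powr: "0 < p \<Longrightarrow> pnorm p t y powr p = t powr p + y powr p"
  by (simp add: pnorm_def powr_powr)

lemma pnorm_commute: "pnorm p t y = pnorm p y t"
  by (simp add: pnorm_def add.commute)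

lemma pnorm_zero [simp]: "0 < p \<Longrightarrow> 0 \<le> t \<Longrightarrow> pnorm p t 0 = t" "0 < p \<Longrightarrow> 0 \<le> t \<Longrightarrow> pnorm p 0 t = t"
  by (simp_all add: pnorm_def powr_powr)

lemma le_pnorm:
  assumes "0 < p" "0 \<le> t"
  shows "t \<le> pnorm p t y" "t \<le> pnorm p y t"
proof -
  have "(t powr p) powr (1 / p) \<le> (t powr p + y powr p) powr (1 / p)"
    using assms by (intro powr_mono2) auto
  then show "t \<le> pnorm p t y"
    using assms by (simp add: pnorm_def powr_powr)
  then show "t \<le> pnorm p y t"
    by (simp add: pnorm_commute)
qed

lemma pnorm_mono:
  assumes "0 < p" "0 \<le> s" "s \<le> t" "0 \<le> x" "x \<le> y"
  shows "pnorm p s x \<le> pnorm p t y"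
  unfolding pnorm_def using assms by (intro powr_mono2 add_mono) auto

lemma pnorm_eq_0: "0 < p \<Longrightarrow> 0 \<le> t \<Longrightarrow> 0 \<le> y \<Longrightarrow> pnorm p t y = 0 \<Longrightarrow> t = 0 \<and> y = 0"
  using le_pnorm[of p t y] le_pnorm[of p y t] by linarith

lemma pnorm_mult:
  assumes "0 < p" "0 \<le> c" "0 \<le> t" "0 \<le> y"
  shows "pnorm p (c * t) (c * y) = c * pnorm p t y"
proof -
  have "pnorm p (c * t) (c * y) = (c powr p * (t powr p + y powr p)) powr (1 / p)"
    using assms by (simp add: pnorm_def powr_mult distrib_left)
  also have "\<dots> = c * pnorm p t y"
    using assms by (simp add: pnorm_def powr_mult powr_powr)
  finally show ?thesis .
qed

lemma pnorm_normalized: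
  assumes "0 < p" "0 \<le> t" "0 \<le> y" "0 < pnorm p t y"
  shows "(t / pnorm p t y) powr p + (y / pnorm p t y) powr p = 1"
proof -
  have "0 < pnorm p t y powr p"
    using assms by simp
  moreover have "(t / pnorm p t y) powr p + (y / pnorm p t y) powr p
      = (t powr p + y powr p) / pnorm p t y powr p"
    using assms by (simp add: powr_divide add_divide_distrib)
  ultimately show ?thesis
    using assms pnorm_powr[of p t y] by simp
qed

text \<open>Hoelder's inequality on two points, read as a statement about convexity: the linear function with
  coefficients \<open>(t / N)^(p - 1)\<close> and \<open>(y / N)^(p - 1)\<close>, where \<open>N = |(t, y)|\<^sub>p\<close>, stays below the norm and touches it
  at \<open>(t, y)\<close>. Convexity, the Lipschitz bound and the monotonicity of the potential are all read
  off this one supporting hyperplane, without derivatives.\<close>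

lemma pnorm_support:
  assumes p: "1 < p" and nn: "0 \<le> s" "0 \<le> u" "0 \<le> t" "0 \<le> y"
  shows "(t / pnorm p t y) powr (p - 1) * s + (y / pnorm p t y) powr (p - 1) * u \<le> pnorm p s u"
proof (cases "pnorm p t y = 0 \<or> pnorm p s u = 0")
  case True
  then show ?thesis
    using p nn pnorm_eq_0[of p s u] by (auto simp: powr_def)
next
  case False
  define n where "n = pnorm p t y"
  define m where "m = pnorm p s u"
  define q where "q = p / (p - 1)"
  have pos: "0 < n" "0 < m"
    using False by (auto simp: n_def m_def less_le)
  have q: "1 < q" "1 / q + 1 / p = 1"
    using p by (auto simp: q_def field_simps)
  have 1: "(a / n) powr (p - 1) * (b / m) \<le> (a / n) powr p / q + (b / m) powr p / p"
    if "0 \<le> a" "0 \<le> b" for a b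
  proof -
    have "((a / n) powr (p - 1)) powr q = (a / n) powr p"
      using p by (simp add: powr_powr q_def)
    then show ?thesis
      using Youngs_inequality[of q p "(a / n) powr (p - 1)" "b / m"] p q pos that by simp
  qed
  have "((t / n) powr (p - 1) * s + (y / n) powr (p - 1) * u) / m
      = (t / n) powr (p - 1) * (s / m) + (y / n) powr (p - 1) * (u / m)"
    by (simp add: add_divide_distrib)
  also have "\<dots> \<le> ((t / n) powr p + (y / n) powr p) / q + ((s / m) powr p + (u / m) powr p) / p"
    using 1[of t s] 1[of y u] nn by (simp add: add_divide_distrib)
  also have "(t / n) powr p + (y / n) powr p = 1"
    using pnorm_normalized[of p t y] nn p pos by (simp add: n_def)
  also have "(s / m) powr p + (u / m) powr p = 1"
    using pnorm_normalized[of p s u] nn p pos by (simp add: m_def)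
  finally have "((t / n) powr (p - 1) * s + (y / n) powr (p - 1) * u) / m \<le> 1"
    using q(2) by linarith
  then show ?thesis
    using pos by (simp add: n_def[symmetric] m_def[symmetric] divide_le_eq)
qed

lemma pnorm_support_self:
  assumes p: "1 < p" and nn: "0 \<le> t" "0 \<le> y"
  shows "(t / pnorm p t y) powr (p - 1) * t + (y / pnorm p t y) powr (p - 1) * y = pnorm p t y"
proof (cases "pnorm p t y = 0")
  case True
  then show ?thesis using pnorm_eq_0[of p t y] p nn by simp
next
  case False
  define n where "n = pnorm p t y"
  have pos: "0 < n" using False by (auto simp: n_def less_le)
  have 1: "(a / n) powr (p - 1) * a = n * (a / n) powr p" if "0 \<le> a" for a
  proof (cases "a = 0")
    case False
    then have "(a / n) powr p = (a / n) powr (p - 1) * (a / n)"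
      using that pos powr_add[of "a / n" "p - 1" 1] by simp
    then show ?thesis using pos by simp
  qed simp
  have "(t / n) powr p + (y / n) powr p = 1"
    using pnorm_normalized[of p t y] nn p pos by (simp add: n_def)
  then have "n * (t / n) powr p + n * (y / n) powr p = n"
    by (metis distrib_left mult.right_neutral)
  then show ?thesis
    using 1 nn by (simp add: n_def)
qed

lemma pnorm_slope_le_1:
  assumes "1 < p" "0 \<le> t" "0 \<le> y"
  shows "(t / pnorm p t y) powr (p - 1) \<le> 1"
proof -
  have "t / pnorm p t y \<le> 1"
    using le_pnorm[of p t y] assms by (simp add: divide_le_eq_1 less_le)
  then show ?thesis
    using powr_mono2[of "p - 1" "t / pnorm p t y" 1] assms by simp
qed

lemma pnorm_tangent:
  assumes "1 < p" "0 \<le> t" "0 \<le> y" "0 \<le> s"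
  shows "pnorm p t y + (t / pnorm p t y) powr (p - 1) * (s - t) \<le> pnorm p s y"
  using pnorm_support[of p s y t y] pnorm_support_self[of p t y] assms
  by (simp add: right_diff_distrib)

lemma pnorm_Lipschitz:
  assumes "1 < p" "0 \<le> t" "0 \<le> y" "0 \<le> s"
  shows "\<bar>pnorm p s y - pnorm p t y\<bar> \<le> \<bar>s - t\<bar>"
proof -
  have *: "pnorm p t y - pnorm p s y \<le> \<bar>s - t\<bar>" if "0 \<le> s" "0 \<le> t" for s t
  proof -
    let ?r = "(t / pnorm p t y) powr (p - 1)"
    have "?r * (t - s) \<le> ?r * \<bar>s - t\<bar>" by (intro mult_left_mono) auto
    also have "\<dots> \<le> 1 * \<bar>s - t\<bar>"
      using pnorm_slope_le_1[of p t y] assms that by (intro mult_right_mono) auto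
    finally show ?thesis
      using pnorm_tangent[of p t y s] assms that by (simp add: right_diff_distrib)
  qed
  show ?thesis using *[of s t] *[of t s] assms by (simp add: abs_le_iff)
qed

lemma powr_midpoint_le:
  fixes a b p :: real
  assumes "1 \<le> p" "0 \<le> a" "0 \<le> b"
  shows "((a + b) / 2) powr p \<le> (a powr p + b powr p) / 2"
proof -
  have half: "(c / 2) powr p \<le> c powr p / 2" if "0 \<le> c" for c :: real
  proof -
    have "(c / 2) powr p = (1 / 2) powr p * c powr p"
      using that powr_mult[of "1 / 2" c p] by simp
    also have "\<dots> \<le> 1 / 2 * c powr p"
      using powr_le_one_le[of "1 / 2" p] assms by (intro mult_right_mono) auto
    finally show ?thesis by simp
  qed
  consider "a = 0" | "b = 0" | "0 < a" "0 < b"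
    using assms by linarith
  then show ?thesis
  proof cases
    case 3
    then show ?thesis
      using convex_onD[OF powr_convex[of p], of "1 / 2" a b] assms by (simp add: field_simps)
  qed (use half[of a] half[of b] assms in auto)
qed

text \<open>Smoothness of \<open>X\<close> in the form used at each time step. The map \<open>x \<mapsto> |(|x|, y)|\<^sub>p\<close> inherits the defining
  inequality of \<open>X\<close> because the mean of two numbers is at most their \<open>p\<close>-mean. The point is the error
  term: as \<open>y\<close> is at least \<open>C\<close> times the square function \<open>s\<close>, the error is largest when
  \<open>|(|x|, y)|\<^sub>p = C s\<close>, and then it equals \<open>C\<close> times the increment of the square function. So the
  errors telescope, for small and for large jumps alike, and the jumps need not be split
  as in Davis' decomposition.\<close>

lemma pnorm_smooth:
  assumes sm: "smooth_banach TYPE('x::banach) p C" and p: "1 < p"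
    and y: "C * s \<le> y" and s: "0 \<le> s"
  shows "(pnorm p (norm (x + d)) y + pnorm p (norm (x - d :: 'x)) y) / 2
         \<le> pnorm p (norm x) y + C * (pnorm p s (norm d) - s)"
proof -
  have C: "0 < C" using sm by (simp add: smooth_banach_def)
  have y0: "0 \<le> y" using y s C mult_nonneg_nonneg[of C s] by linarith
  define a where "a = pnorm p (norm (x + d)) y"
  define b where "b = pnorm p (norm (x - d)) y"
  have nn: "0 \<le> a" "0 \<le> b" by (auto simp: a_def b_def)
  have "((a + b) / 2) powr p \<le> (a powr p + b powr p) / 2"
    using p nn by (intro powr_midpoint_le) auto
  also have "\<dots> = (norm (x + d) powr p + norm (x - d) powr p) / 2 + y powr p"
    using p by (simp add: a_def b_def pnorm_powr)
  also have "\<dots> \<le> norm x powr p + C powr p * norm d powr p + y powr p"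
    using sm by (auto simp: smooth_banach_def)
  also have "\<dots> = pnorm p (pnorm p (norm x) y) (C * norm d) powr p"
    using p C by (simp add: pnorm_powr powr_mult)
  finally have "(a + b) / 2 \<le> pnorm p (pnorm p (norm x) y) (C * norm d)"
    using p powr_less_mono2[of p "pnorm p (pnorm p (norm x) y) (C * norm d)" "(a + b) / 2"]
    by fastforce
  also have "\<dots> \<le> pnorm p (norm x) y + C * (pnorm p s (norm d) - s)"
  proof -
    \<comment> \<open>the Lipschitz bound of the norm, between the first arguments \<open>C s\<close> and \<open>|(|x|, y)|\<^sub>p\<close>\<close>
    have "C * s \<le> pnorm p (norm x) y"
      using y le_pnorm(2)[of p y "norm x"] p y0 by linarith
    then show ?thesis
      using pnorm_Lipschitz[of p "C * s" "C * norm d" "pnorm p (norm x) y"]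
        pnorm_mult[of p C s "norm d"] p C s by (simp add: right_diff_distrib)
  qed
  finally show ?thesis by (simp add: a_def b_def)
qed

text \<open>For \<open>p \<le> 2\<close> the \<open>\<ell>\<^sup>p\<close> norm dominates the \<open>\<ell>\<^sup>2\<close> norm, so that \<open>d\<^sup>2 \<le> s'\<^sup>2 - s\<^sup>2\<close> where \<open>s' = |(s, d)|\<^sub>p\<close>. This is
  all that the bound on the interaction with the weight has to know about the square function.\<close>

lemma pnorm_square_increment:
  assumes p: "1 < p" "p \<le> 2" and nn: "0 \<le> s" "0 \<le> d"
  shows "d\<^sup>2 \<le> 2 * pnorm p s d * (pnorm p s d - s)"
proof (cases "pnorm p s d = 0")
  case True
  then show ?thesis using pnorm_eq_0[of p s d] p nn by simp
next
  case False
  define n where "n = pnorm p s d"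
  have pos: "0 < n" using False by (auto simp: n_def less_le)
  have le: "s \<le> n" "d \<le> n" using le_pnorm p nn by (auto simp: n_def)
  have 1: "(a / n)\<^sup>2 \<le> (a / n) powr p" if "0 \<le> a" "a \<le> n" for a
  proof (cases "a = 0")
    case False
    then have "(a / n) powr 2 \<le> (a / n) powr p"
      using that pos p by (intro powr_mono') auto
    then show ?thesis using that pos by simp
  qed simp
  have "(s / n)\<^sup>2 + (d / n)\<^sup>2 \<le> (s / n) powr p + (d / n) powr p"
    using 1 nn le by (simp add: add_mono)
  also have "\<dots> = 1"
    using pnorm_normalized[of p s d] nn p pos by (simp add: n_def)
  finally have "s\<^sup>2 + d\<^sup>2 \<le> n\<^sup>2"
    using pos by (simp add: power_divide add_divide_distrib[symmetric])
  moreover have "0 \<le> (n - s)\<^sup>2" by simp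
  ultimately show ?thesis
    by (simp add: n_def[symmetric] power2_eq_square algebra_simps)
qed

text \<open>The Bellman function of the problem, at \<open>t = |f\<^sub>n|\<close> and \<open>y = max (f\<^sub>n\<^sup>*) (C s\<^sub>n)\<close>. It dominates \<open>y\<close>, it is a
  smooth convex function of \<open>f\<^sub>n\<close>, and for large \<open>k\<close> it does not grow when the maximum is updated to a
  new record \<open>y = t\<close>, as its two terms then balance.\<close>

definition max_potential :: "real \<Rightarrow> real \<Rightarrow> real \<Rightarrow> real \<Rightarrow> real" where
  "max_potential p k t y = k * pnorm p t y - (k - 1) * y"

lemma max_potential_ge:
  assumes "1 < p" "0 \<le> y" "0 \<le> k"
  shows "y \<le> max_potential p k t y"
  using mult_left_mono[OF le_pnorm(2)[of p y t], of k] assms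
  by (simp add: max_potential_def algebra_simps)

lemma max_potential_support:
  assumes "1 < p" "0 \<le> t" "0 \<le> y" "0 \<le> z" "0 \<le> k"
  shows "max_potential p k t z \<le> max_potential p k t y + (k * (z / pnorm p t z) powr (p - 1) - (k - 1)) * (z - y)"
  using mult_left_mono[OF pnorm_tangent[of p z t y], of k] assms
  by (simp add: max_potential_def algebra_simps pnorm_commute[of p _ t])

lemma max_potential_slope_le_1:
  assumes "1 < p" "0 \<le> t" "0 \<le> y" "y \<le> z" "0 \<le> k"
  shows "max_potential p k t z \<le> max_potential p k t y + (z - y)"
proof -
  have "k * (z / pnorm p t z) powr (p - 1) \<le> k * 1"
    using pnorm_slope_le_1[of p z t] assms
    by (intro mult_left_mono) (auto simp: pnorm_commute[of p _ t])
  then have "(k * (z / pnorm p t z) powr (p - 1) - (k - 1)) * (z - y) \<le> 1 * (z - y)"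
    using assms by (intro mult_right_mono) auto
  then show ?thesis using max_potential_support[of p t y z k] assms by simp
qed

text \<open>The only place that determines \<open>k\<close>. On \<open>y \<le> t\<close> the potential is convex in \<open>y\<close>, hence nonincreasing
  once its slope at \<open>y = t\<close> is nonpositive, which amounts to \<open>k (1 - 2 powr (-1/p')) \<ge> 1\<close>. Since
  \<open>2 powr (-u) \<le> 1 - u / 2\<close> for \<open>0 \<le> u \<le> 1\<close>, the value \<open>k = 2 p'\<close> suffices; this is where the factor \<open>p'\<close> of the
  theorem comes from.\<close>

lemma max_potential_diagonal:
  assumes p: "1 < p" "1 / p + 1 / p' = 1" and "0 \<le> y" "y \<le> t"
  shows "max_potential p (2 * p') t t \<le> max_potential p (2 * p') t y"
proof (cases "t = 0")
  case True
  then show ?thesis using assms by simp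
next
  case False
  then have t: "0 < t" using assms by simp
  have p': "1 < p'" by (rule conjugate_exponent_gt_1[OF p])
  have "t / pnorm p t t = (1 / 2) powr (1 / p)"
  proof -
    have "pnorm p t t = t * pnorm p 1 1"
      using pnorm_mult[of p t 1 1] p t by simp
    then show ?thesis using t by (simp add: pnorm_def powr_divide)
  qed
  moreover have "1 / p * (p - 1) = 1 / p'"
    using p by (simp add: field_simps)
  ultimately have "(t / pnorm p t t) powr (p - 1) = (1 / 2) powr (1 / p')"
    by (simp only: powr_powr)
  also have "\<dots> \<le> 1 / (2 * p') + 1 / p"
    using Youngs_inequality_0[of "1 / p'" "1 / p" "1 / 2" 1] p p' by (simp add: add.commute)
  finally have "2 * p' * (t / pnorm p t t) powr (p - 1) \<le> 2 * p' * (1 / (2 * p') + 1 / p)"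
    using p' by (intro mult_left_mono) auto
  also have "1 / (2 * p') + 1 / p = 1 - 1 / (2 * p')"
    using p(2) divide_divide_eq_left'[of 1 p' 2] by linarith
  also have "2 * p' * (1 - 1 / (2 * p')) = 2 * p' - 1" using p' by (simp add: field_simps)
  finally have "(2 * p' * (t / pnorm p t t) powr (p - 1) - (2 * p' - 1)) * (t - y) \<le> 0"
    using assms by (intro mult_nonpos_nonneg) auto
  then show ?thesis
    using max_potential_support[of p t y t "2 * p'"] assms p' by simp
qed

text \<open>An update of \<open>y\<close> by a new record of \<open>|f|\<close> costs nothing, and an update by the growth of the square
  function, from \<open>c = C s\<close> to \<open>c' = C s'\<close>, costs at most \<open>c' - c\<close>.\<close>

lemma max_potential_update:
  assumes p: "1 < p" "1 / p + 1 / p' = 1" and "0 \<le> p'" "0 \<le> y" "0 \<le> t" "c \<le> y" "c \<le> c'"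
  shows "max_potential p (2 * p') t (max (max y t) c') \<le> max_potential p (2 * p') t y + (c' - c)"
proof -
  have "max_potential p (2 * p') t (max y t) \<le> max_potential p (2 * p') t y"
    using max_potential_diagonal[of p p' y t] assms by (auto simp: max_def)
  moreover have "max_potential p (2 * p') t (max (max y t) c') \<le> max_potential p (2 * p') t (max y t) + (c' - c)"
    using max_potential_slope_le_1[of p t "max y t" "max (max y t) c'" "2 * p'"] assms
    by (smt (verit))
  ultimately show ?thesis by simp
qed

section \<open>Strong measurability and Jensen's inequality\<close>

lemma strongly_measurable_norm:
  assumes "strongly_measurable M u"
  shows "(\<lambda>\<omega>. norm (u \<omega>)) \<in> borel_measurable M"
proof -
  obtain s where "\<forall>i. simple_function M (s i)" "\<forall>\<omega>\<in>space M. (\<lambda>i::nat. s i \<omega>) \<longlonglongrightarrow> u \<omega>"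
    using assms unfolding strongly_measurable_def by (elim exE conjE)
  note s = this[rule_format]
  show ?thesis
  proof (rule borel_measurable_LIMSEQ_metric)
    show "(\<lambda>\<omega>. norm (s i \<omega>)) \<in> borel_measurable M" for i
      by (rule borel_measurable_simple_function, rule simple_function_compose1[where g=norm], rule s)
    show "(\<lambda>i. norm (s i \<omega>)) \<longlonglongrightarrow> norm (u \<omega>)" if "\<omega> \<in> space M" for \<omega>
      by (intro tendsto_norm s that)
  qed
qed

lemma strongly_measurable_diff:
  assumes "strongly_measurable M u" "strongly_measurable M v"
  shows "strongly_measurable M (\<lambda>\<omega>. u \<omega> - v \<omega>)"
proof -
  obtain s where "\<forall>i. simple_function M (s i)" "\<forall>\<omega>\<in>space M. (\<lambda>i::nat. s i \<omega>) \<longlonglongrightarrow> u \<omega>"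
    using assms(1) unfolding strongly_measurable_def by (elim exE conjE)
  note s = this[rule_format]
  obtain t where "\<forall>i. simple_function M (t i)" "\<forall>\<omega>\<in>space M. (\<lambda>i::nat. t i \<omega>) \<longlonglongrightarrow> v \<omega>"
    using assms(2) unfolding strongly_measurable_def by (elim exE conjE)
  note t = this[rule_format]
  have "simple_function M (\<lambda>\<omega>. s i \<omega> - t i \<omega>)" for i
    by (rule simple_function_compose2[where h="(-)"]) (rule s t)+
  moreover have "(\<lambda>i. s i \<omega> - t i \<omega>) \<longlonglongrightarrow> u \<omega> - v \<omega>" if "\<omega> \<in> space M" for \<omega>
    by (intro tendsto_diff s t that)
  ultimately show ?thesis
    unfolding strongly_measurable_def by (intro exI[of _ "\<lambda>i \<omega>. s i \<omega> - t i \<omega>"]) auto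
qed

lemma simple_function_from_subalgebra:
  assumes "subalgebra M F" "simple_function F s"
  shows "simple_function M s"
  using assms unfolding subalgebra_def simple_function_def by auto

lemma strongly_measurable_from_subalgebra:
  assumes "subalgebra M F" "strongly_measurable F u"
  shows "strongly_measurable M u"
proof -
  obtain s where "\<forall>i. simple_function F (s i)" "\<forall>\<omega>\<in>space F. (\<lambda>i::nat. s i \<omega>) \<longlonglongrightarrow> u \<omega>"
    using assms(2) unfolding strongly_measurable_def by (elim exE conjE)
  note s = this[rule_format]
  moreover have "space F = space M"
    using assms(1) by (simp add: subalgebra_def)
  ultimately show ?thesis
    unfolding strongly_measurable_def
    by (intro exI[of _ s]) (auto intro: simple_function_from_subalgebra[OF assms(1)])
qed

lemma strongly_measurable_simple: "simple_function M s \<Longrightarrow> strongly_measurable M s"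
  unfolding strongly_measurable_def by (intro exI[of _ "\<lambda>_. s"]) auto

lemma nn_integral_simple_bochner_integrable:
  assumes "Bochner_Integration.simple_bochner_integrable M s"
  shows "(\<integral>\<^sup>+\<omega>. ennreal (norm (s \<omega>)) \<partial>M) < \<infinity>"
    "ennreal (norm (Bochner_Integration.simple_bochner_integral M s)) \<le> (\<integral>\<^sup>+\<omega>. ennreal (norm (s \<omega>)) \<partial>M)"
proof -
  have "Bochner_Integration.simple_bochner_integrable M (\<lambda>\<omega>. norm (s \<omega>))"
    using simple_bochner_integrable_compose2[of "\<lambda>x y. norm x" M s s] assms by simp
  from simple_bochner_integral_eq_nn_integral[OF this]
  have eq: "(\<integral>\<^sup>+\<omega>. ennreal (norm (s \<omega>)) \<partial>M)
      = ennreal (Bochner_Integration.simple_bochner_integral M (\<lambda>\<omega>. norm (s \<omega>)))"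
    by simp
  show "(\<integral>\<^sup>+\<omega>. ennreal (norm (s \<omega>)) \<partial>M) < \<infinity>"
    unfolding eq by simp
  show "ennreal (norm (Bochner_Integration.simple_bochner_integral M s)) \<le> (\<integral>\<^sup>+\<omega>. ennreal (norm (s \<omega>)) \<partial>M)"
    unfolding eq by (intro ennreal_leI simple_bochner_integral_norm_bound assms)
qed

lemma has_strong_integral_integrable_norm:
  assumes "has_strong_integral M u I"
  shows "integrable M (\<lambda>\<omega>. norm (u \<omega>))"
proof (rule integrableI_bounded)
  obtain s where "strongly_measurable M u"
    "\<forall>i. Bochner_Integration.simple_bochner_integrable M (s i)"
    "(\<lambda>i::nat. \<integral>\<^sup>+\<omega>. ennreal (norm (u \<omega> - s i \<omega>)) \<partial>M) \<longlonglongrightarrow> 0"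
    using assms unfolding has_strong_integral_def by (elim exE conjE)
  note s = this[rule_format]
  show meas[measurable]: "(\<lambda>\<omega>. norm (u \<omega>)) \<in> borel_measurable M"
    by (rule strongly_measurable_norm[OF s(1)])
  have "\<forall>\<^sub>F i in sequentially. (\<integral>\<^sup>+\<omega>. ennreal (norm (u \<omega> - s i \<omega>)) \<partial>M) < 1"
    by (rule order_tendstoD(2)[OF s(3)]) simp
  then obtain i where i: "(\<integral>\<^sup>+\<omega>. ennreal (norm (u \<omega> - s i \<omega>)) \<partial>M) < 1"
    by (auto simp: eventually_sequentially)
  have si: "strongly_measurable M (s i)"
    using s(2)[of i] by (auto elim!: simple_bochner_integrable.cases intro: strongly_measurable_simple)
  have [measurable]: "(\<lambda>\<omega>. norm (s i \<omega>)) \<in> borel_measurable M"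
    "(\<lambda>\<omega>. norm (u \<omega> - s i \<omega>)) \<in> borel_measurable M"
    by (intro strongly_measurable_norm strongly_measurable_diff si s(1))+
  have "(\<integral>\<^sup>+\<omega>. ennreal (norm (u \<omega>)) \<partial>M)
      \<le> (\<integral>\<^sup>+\<omega>. ennreal (norm (u \<omega> - s i \<omega>)) + ennreal (norm (s i \<omega>)) \<partial>M)"
    using norm_triangle_sub[of "u _" "s i _"]
    by (intro nn_integral_mono) (auto simp flip: ennreal_plus simp: add.commute intro!: ennreal_leI)
  also have "\<dots> = (\<integral>\<^sup>+\<omega>. ennreal (norm (u \<omega> - s i \<omega>)) \<partial>M) + (\<integral>\<^sup>+\<omega>. ennreal (norm (s i \<omega>)) \<partial>M)"
    by (intro nn_integral_add) auto
  also have "\<dots> < \<infinity>"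
    using i nn_integral_simple_bochner_integrable(1)[OF s(2)[of i]]
    by (auto simp: less_top[symmetric])
  finally show "(\<integral>\<^sup>+\<omega>. ennreal (norm (norm (u \<omega>))) \<partial>M) < \<infinity>" by simp
qed

context finite_measure
begin

text \<open>The triangle inequality for the integral of \<open>c - (u - v)\<close> over \<open>A\<close>, when \<open>u\<close> and \<open>v\<close> have the same
  integral. As \<open>X\<close> need not be separable, the inequality is passed on from approximating simple
  functions.\<close>

lemma norm_le_nn_integral_shifted:
  fixes u v :: "'a \<Rightarrow> 'x::real_normed_vector"
  assumes u: "has_strong_integral M u I" and v: "has_strong_integral M v I" and A: "A \<in> sets M"
  shows "ennreal (measure M A * norm c) \<le> (\<integral>\<^sup>+\<omega>. ennreal (norm (indicator A \<omega> *\<^sub>R c - (u \<omega> - v \<omega>))) \<partial>M)"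
proof -
  obtain s where "strongly_measurable M u"
    "\<forall>i. Bochner_Integration.simple_bochner_integrable M (s i)"
    "(\<lambda>i::nat. \<integral>\<^sup>+\<omega>. ennreal (norm (u \<omega> - s i \<omega>)) \<partial>M) \<longlonglongrightarrow> 0"
    "(\<lambda>i. Bochner_Integration.simple_bochner_integral M (s i)) \<longlonglongrightarrow> I"
    using u unfolding has_strong_integral_def by (elim exE conjE)
  note s = this[rule_format]
  obtain t where "strongly_measurable M v"
    "\<forall>i. Bochner_Integration.simple_bochner_integrable M (t i)"
    "(\<lambda>i::nat. \<integral>\<^sup>+\<omega>. ennreal (norm (v \<omega> - t i \<omega>)) \<partial>M) \<longlonglongrightarrow> 0"
    "(\<lambda>i. Bochner_Integration.simple_bochner_integral M (t i)) \<longlonglongrightarrow> I"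
    using v unfolding has_strong_integral_def by (elim exE conjE)
  note t = this[rule_format]
  define k where "k = (\<lambda>\<omega>. indicator A \<omega> *\<^sub>R c)"
  have k_simple: "simple_function M k"
    unfolding k_def
    by (rule simple_function_compose1[where g="\<lambda>r. r *\<^sub>R c" and f="indicator A :: _ \<Rightarrow> real"],
        rule simple_function_indicator[OF A])
  have k: "Bochner_Integration.simple_bochner_integrable M k"
    by (intro simple_bochner_integrable.intros k_simple) simp
  have k_int: "Bochner_Integration.simple_bochner_integral M k = measure M A *\<^sub>R c"
  proof -
    have 1: "Bochner_Integration.simple_bochner_integrable M (indicator A :: _ \<Rightarrow> real)"
      using A by (intro simple_bochner_integrable.intros simple_function_indicator) simp_all
    have "Bochner_Integration.simple_bochner_integral M (indicator A :: _ \<Rightarrow> real) = measure M A"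
      using simple_bochner_integrable_eq_integral[OF 1] A by (simp add: Int_absorb2 sets.sets_into_space)
    then show ?thesis
      unfolding k_def
      using simple_bochner_integral_linear[OF bounded_linear.linear[OF bounded_linear_scaleR_left[of c]] 1]
      by simp
  qed
  define r where "r = (\<lambda>i \<omega>. k \<omega> - (s i \<omega> - t i \<omega>))"
  have st: "Bochner_Integration.simple_bochner_integrable M (\<lambda>\<omega>. s i \<omega> - t i \<omega>)" for i
    using simple_bochner_integrable_compose2[of "(-)" M "s i" "t i"] s t by simp
  have r: "Bochner_Integration.simple_bochner_integrable M (r i)" for i
    unfolding r_def using simple_bochner_integrable_compose2[of "(-)" M k, OF _ k st[of i]] by simp
  have r_int: "Bochner_Integration.simple_bochner_integral M (r i) = measure M A *\<^sub>R c
      - (Bochner_Integration.simple_bochner_integral M (s i) - Bochner_Integration.simple_bochner_integral M (t i))" for i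
    unfolding r_def by (simp add: simple_bochner_integral_diff k st s t k_int)
  have simple_sm: "strongly_measurable M h" if "Bochner_Integration.simple_bochner_integrable M h" for h :: "'a \<Rightarrow> 'x"
    using that by (auto elim!: simple_bochner_integrable.cases intro: strongly_measurable_simple)
  have meas[measurable]: "(\<lambda>\<omega>. norm (k \<omega> - (u \<omega> - v \<omega>))) \<in> borel_measurable M"
    "(\<lambda>\<omega>. norm (u \<omega> - s i \<omega>)) \<in> borel_measurable M" "(\<lambda>\<omega>. norm (v \<omega> - t i \<omega>)) \<in> borel_measurable M" for i
    by (intro strongly_measurable_norm strongly_measurable_diff simple_sm k s t)+
  have bound: "ennreal (norm (Bochner_Integration.simple_bochner_integral M (r i)))
      \<le> (\<integral>\<^sup>+\<omega>. ennreal (norm (k \<omega> - (u \<omega> - v \<omega>))) \<partial>M)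
        + ((\<integral>\<^sup>+\<omega>. ennreal (norm (u \<omega> - s i \<omega>)) \<partial>M) + (\<integral>\<^sup>+\<omega>. ennreal (norm (v \<omega> - t i \<omega>)) \<partial>M))" for i
  proof -
    have "ennreal (norm (Bochner_Integration.simple_bochner_integral M (r i))) \<le> (\<integral>\<^sup>+\<omega>. ennreal (norm (r i \<omega>)) \<partial>M)"
      by (rule nn_integral_simple_bochner_integrable(2)[OF r])
    also have "\<dots> \<le> (\<integral>\<^sup>+\<omega>. ennreal (norm (k \<omega> - (u \<omega> - v \<omega>)))
        + (ennreal (norm (u \<omega> - s i \<omega>)) + ennreal (norm (v \<omega> - t i \<omega>))) \<partial>M)"
    proof (rule nn_integral_mono)
      fix \<omega>
      have "r i \<omega> = (k \<omega> - (u \<omega> - v \<omega>)) + ((u \<omega> - s i \<omega>) - (v \<omega> - t i \<omega>))"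
        by (simp add: r_def)
      then have "norm (r i \<omega>) \<le> norm (k \<omega> - (u \<omega> - v \<omega>)) + (norm (u \<omega> - s i \<omega>) + norm (v \<omega> - t i \<omega>))"
        by (metis norm_triangle_ineq norm_triangle_ineq4 add_left_mono order_trans)
      then show "ennreal (norm (r i \<omega>)) \<le> ennreal (norm (k \<omega> - (u \<omega> - v \<omega>)))
        + (ennreal (norm (u \<omega> - s i \<omega>)) + ennreal (norm (v \<omega> - t i \<omega>)))"
        by (simp flip: ennreal_plus add: ennreal_leI)
    qed
    finally show ?thesis by (simp add: nn_integral_add)
  qed
  have "(\<lambda>i. ennreal (norm (Bochner_Integration.simple_bochner_integral M (r i)))) \<longlonglongrightarrow> ennreal (norm (measure M A *\<^sub>R c - (I - I)))"
    unfolding r_int by (intro tendsto_ennrealI tendsto_norm tendsto_diff tendsto_const s t)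
  moreover have "(\<lambda>i. (\<integral>\<^sup>+\<omega>. ennreal (norm (k \<omega> - (u \<omega> - v \<omega>))) \<partial>M)
        + ((\<integral>\<^sup>+\<omega>. ennreal (norm (u \<omega> - s i \<omega>)) \<partial>M) + (\<integral>\<^sup>+\<omega>. ennreal (norm (v \<omega> - t i \<omega>)) \<partial>M)))
     \<longlonglongrightarrow> (\<integral>\<^sup>+\<omega>. ennreal (norm (k \<omega> - (u \<omega> - v \<omega>))) \<partial>M) + (0 + 0)"
    by (intro tendsto_add tendsto_const s t)
  ultimately have "ennreal (norm (measure M A *\<^sub>R c - (I - I))) \<le> (\<integral>\<^sup>+\<omega>. ennreal (norm (k \<omega> - (u \<omega> - v \<omega>))) \<partial>M) + (0 + 0)"
    by (rule LIMSEQ_le) (use bound in blast)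
  then show ?thesis by (simp add: k_def)
qed

end

context finite_measure_subalgebra
begin

lemma real_cond_exp_nonneg_of_set_integrals:
  assumes Z: "integrable M Z" and pos: "\<And>A. A \<in> sets F \<Longrightarrow> 0 \<le> (\<integral>\<omega>. indicator A \<omega> * Z \<omega> \<partial>M)"
  shows "AE \<omega> in M. 0 \<le> real_cond_exp M F Z \<omega>"
proof -
  define A where "A = {\<omega> \<in> space F. real_cond_exp M F Z \<omega> < 0}"
  have A: "A \<in> sets F" unfolding A_def by measurable
  then have AM[measurable]: "A \<in> sets M" using subalg by (auto simp: subalgebra_def)
  have int: "integrable M (\<lambda>\<omega>. indicator A \<omega> * Z \<omega>)"
    using integrable_mult_indicator[OF AM Z] by simp
  have *: "integrable M (\<lambda>\<omega>. indicator A \<omega> * real_cond_exp M F Z \<omega>)"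
    "(\<integral>\<omega>. indicator A \<omega> * real_cond_exp M F Z \<omega> \<partial>M) = (\<integral>\<omega>. indicator A \<omega> * Z \<omega> \<partial>M)"
    using real_cond_exp_intg[of "indicator A" Z] int A Z by auto
  have nonneg: "AE \<omega> in M. 0 \<le> - (indicator A \<omega> * real_cond_exp M F Z \<omega>)"
    by (intro AE_I2) (simp add: A_def indicator_def)
  have "(\<integral>\<omega>. - (indicator A \<omega> * real_cond_exp M F Z \<omega>) \<partial>M) = 0"
    using pos[OF A] integral_nonneg_AE[OF nonneg] *(2) by (simp only: integral_minus)
  then have "AE \<omega> in M. - (indicator A \<omega> * real_cond_exp M F Z \<omega>) = 0"
    using integral_nonneg_eq_0_iff_AE[OF integrable_minus[OF *(1)] nonneg] by blast
  with AE_space show ?thesis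
  proof eventually_elim
    case (elim \<omega>)
    then have "\<omega> \<in> A \<or> 0 \<le> real_cond_exp M F Z \<omega>"
      using subalg by (auto simp: A_def subalgebra_def)
    then show ?case using elim(2) by auto
  qed
qed

text \<open>The conditional Jensen inequality \<open>E(|x - d| | F) \<ge> |x|\<close> for a martingale difference \<open>d = h - g\<close> and an
  \<open>F\<close>-measurable \<open>x\<close>, integrated against an \<open>F\<close>-measurable density \<open>\<rho>\<close>. Stating it through the difference
  \<open>|x - d| - |x|\<close>, which is bounded by the integrable function \<open>|d|\<close>, allows an arbitrary strongly measurable
  \<open>x\<close>, and needs no conditional expectation of vector-valued functions. The integral is treated for
  constant \<open>x\<close>, then simple \<open>x\<close>, then in the limit; the density comes last, because nonnegative
  integrals over all sets of \<open>F\<close> mean a nonnegative real conditional expectation.\<close>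

lemma integral_norm_shift_nonneg:
  fixes g h :: "'a \<Rightarrow> 'x::real_normed_vector"
  assumes mart: "\<And>A. A \<in> sets F \<Longrightarrow>
      \<exists>I. has_strong_integral M (\<lambda>\<omega>. indicator A \<omega> *\<^sub>R g \<omega>) I \<and> has_strong_integral M (\<lambda>\<omega>. indicator A \<omega> *\<^sub>R h \<omega>) I"
    and sm: "strongly_measurable M g" "strongly_measurable M h"
    and x: "strongly_measurable F x"
    and \<rho>: "\<rho> \<in> borel_measurable F" "\<And>\<omega>. \<omega> \<in> space M \<Longrightarrow> 0 \<le> \<rho> \<omega>" "\<And>\<omega>. \<omega> \<in> space M \<Longrightarrow> \<rho> \<omega> \<le> B"
  shows "integrable M (\<lambda>\<omega>. \<rho> \<omega> * (norm (x \<omega> - (h \<omega> - g \<omega>)) - norm (x \<omega>)))"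
    "0 \<le> (\<integral>\<omega>. \<rho> \<omega> * (norm (x \<omega> - (h \<omega> - g \<omega>)) - norm (x \<omega>)) \<partial>M)"
proof -
  define d where "d = (\<lambda>\<omega>. h \<omega> - g \<omega>)"
  have d: "strongly_measurable M d" unfolding d_def by (intro strongly_measurable_diff sm)
  have d_int: "integrable M (\<lambda>\<omega>. norm (d \<omega>))"
  proof -
    obtain I where I: "has_strong_integral M (\<lambda>\<omega>. indicator (space F) \<omega> *\<^sub>R g \<omega>) I"
      "has_strong_integral M (\<lambda>\<omega>. indicator (space F) \<omega> *\<^sub>R h \<omega>) I"
      using mart[of "space F"] by auto
    have eq: "integrable M (\<lambda>\<omega>. norm (indicator (space F) \<omega> *\<^sub>R u \<omega>)) = integrable M (\<lambda>\<omega>. norm (u \<omega>))"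
      for u :: "'a \<Rightarrow> 'x"
      using subalg by (intro Bochner_Integration.integrable_cong) (auto simp: subalgebra_def)
    have "integrable M (\<lambda>\<omega>. norm (h \<omega>) + norm (g \<omega>))"
      using I[THEN has_strong_integral_integrable_norm] unfolding eq by simp
    then show ?thesis
      using strongly_measurable_norm[OF d]
      by (rule Bochner_Integration.integrable_bound) (auto simp: d_def intro: order_trans[OF norm_triangle_ineq4])
  qed
  define Z where "Z = (\<lambda>y \<omega>. norm (y \<omega> - d \<omega>) - norm (y \<omega> :: 'x))"
  have Z_meas: "Z y \<in> borel_measurable M" if "strongly_measurable F y" for y
    unfolding Z_def
    by (intro borel_measurable_diff strongly_measurable_norm strongly_measurable_diff d
        strongly_measurable_from_subalgebra[OF subalg] that)
  have Z_bound: "\<bar>Z y \<omega>\<bar> \<le> norm (d \<omega>)" for y \<omega>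
    unfolding Z_def using norm_triangle_ineq3[of "y \<omega> - d \<omega>" "y \<omega>"] by simp
  have Z_int: "integrable M (Z y)" if "strongly_measurable F y" for y
    by (rule Bochner_Integration.integrable_bound[OF d_int Z_meas[OF that]]) (use Z_bound in auto)
  have FM: "A \<in> sets M" if "A \<in> sets F" for A
    using that subalg by (auto simp: subalgebra_def)
  have ind_int: "integrable M (\<lambda>\<omega>. indicator A \<omega> * Z y \<omega>)" if "A \<in> sets F" "strongly_measurable F y" for A y
    using integrable_mult_indicator[OF FM Z_int] that by simp
  have const: "0 \<le> (\<integral>\<omega>. indicator A \<omega> * Z (\<lambda>_. c) \<omega> \<partial>M)" if A: "A \<in> sets F" for A c
  proof -
    note [measurable] = FM[OF A]
    have c: "strongly_measurable F (\<lambda>_. c)" by (intro strongly_measurable_simple) simp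
    obtain I where I: "has_strong_integral M (\<lambda>\<omega>. indicator A \<omega> *\<^sub>R g \<omega>) I"
      "has_strong_integral M (\<lambda>\<omega>. indicator A \<omega> *\<^sub>R h \<omega>) I"
      using mart[OF A] by auto
    have int1: "integrable M (\<lambda>\<omega>. indicator A \<omega> * norm (c - d \<omega>))"
    proof -
      have "integrable M (\<lambda>\<omega>. indicator A \<omega> * Z (\<lambda>_. c) \<omega> + indicator A \<omega> * norm c)"
        by (intro Bochner_Integration.integrable_add ind_int A c integrable_mult_left
            integrable_real_indicator FM[OF A]) (simp add: less_top[symmetric])
      then show ?thesis by (simp add: Z_def algebra_simps)
    qed
    have "ennreal (measure M A * norm c) \<le> (\<integral>\<^sup>+\<omega>. ennreal (norm (indicator A \<omega> *\<^sub>R c - (indicator A \<omega> *\<^sub>R h \<omega> - indicator A \<omega> *\<^sub>R g \<omega>))) \<partial>M)"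
      by (rule norm_le_nn_integral_shifted[OF I(2,1) FM[OF A]])
    also have "\<dots> = (\<integral>\<^sup>+\<omega>. ennreal (indicator A \<omega> * norm (c - d \<omega>)) \<partial>M)"
      by (intro nn_integral_cong) (auto simp: d_def indicator_def)
    also have "\<dots> = ennreal (\<integral>\<omega>. indicator A \<omega> * norm (c - d \<omega>) \<partial>M)"
      using int1 by (intro nn_integral_eq_integral) auto
    finally have "measure M A * norm c \<le> (\<integral>\<omega>. indicator A \<omega> * norm (c - d \<omega>) \<partial>M)"
      by (subst (asm) ennreal_le_iff) (auto intro!: integral_nonneg_AE)
    moreover have "(\<integral>\<omega>. indicator A \<omega> * Z (\<lambda>_. c) \<omega> \<partial>M)
      = (\<integral>\<omega>. indicator A \<omega> * norm (c - d \<omega>) - indicator A \<omega> * norm c \<partial>M)"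
      by (simp add: Z_def algebra_simps)
    moreover have "\<dots> = (\<integral>\<omega>. indicator A \<omega> * norm (c - d \<omega>) \<partial>M) - measure M A * norm c"
    proof (subst Bochner_Integration.integral_diff[OF int1])
      show "integrable M (\<lambda>\<omega>. indicator A \<omega> * norm c)"
        by (intro integrable_mult_left integrable_real_indicator FM[OF A]) (simp add: less_top[symmetric])
    qed (simp add: FM[OF A] Int_absorb2 sets.sets_into_space)
    ultimately show ?thesis by simp
  qed
  have simple: "0 \<le> (\<integral>\<omega>. indicator A \<omega> * Z y \<omega> \<partial>M)" if A: "A \<in> sets F" and y: "simple_function F y" for A y
  proof -
    have fin: "finite (y ` space F)" and pre: "y -` {c} \<inter> space F \<in> sets F" for c
      using simple_functionD[OF y] by auto
    have "(\<integral>\<omega>. indicator A \<omega> * Z y \<omega> \<partial>M)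
      = (\<integral>\<omega>. (\<Sum>c\<in>y ` space F. indicator (A \<inter> (y -` {c} \<inter> space F)) \<omega> * Z (\<lambda>_. c) \<omega>) \<partial>M)"
    proof (intro Bochner_Integration.integral_cong refl)
      fix \<omega> assume "\<omega> \<in> space M"
      then have \<omega>: "\<omega> \<in> space F" using subalg by (simp add: subalgebra_def)
      have "(\<Sum>c\<in>y ` space F. indicator (A \<inter> (y -` {c} \<inter> space F)) \<omega> * Z (\<lambda>_. c) \<omega>)
          = (\<Sum>c\<in>y ` space F. if c = y \<omega> then indicator A \<omega> * Z y \<omega> else 0)"
        using \<omega> by (intro sum.cong) (auto simp: indicator_def Z_def)
      then show "indicator A \<omega> * Z y \<omega> = (\<Sum>c\<in>y ` space F. indicator (A \<inter> (y -` {c} \<inter> space F)) \<omega> * Z (\<lambda>_. c) \<omega>)"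
        using fin \<omega> by simp
    qed
    also have "\<dots> = (\<Sum>c\<in>y ` space F. \<integral>\<omega>. indicator (A \<inter> (y -` {c} \<inter> space F)) \<omega> * Z (\<lambda>_. c) \<omega> \<partial>M)"
      using A pre by (intro Bochner_Integration.integral_sum ind_int strongly_measurable_simple) auto
    also have "0 \<le> \<dots>"
      using A pre by (intro sum_nonneg const) auto
    finally show ?thesis .
  qed
  have sets: "0 \<le> (\<integral>\<omega>. indicator A \<omega> * Z x \<omega> \<partial>M)" if A: "A \<in> sets F" for A
  proof -
    obtain s where "\<forall>i. simple_function F (s i)" "\<forall>\<omega>\<in>space F. (\<lambda>i::nat. s i \<omega>) \<longlonglongrightarrow> x \<omega>"
    using x unfolding strongly_measurable_def by (elim exE conjE)
  note s = this[rule_format]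
    have "(\<lambda>i. \<integral>\<omega>. indicator A \<omega> * Z (s i) \<omega> \<partial>M) \<longlonglongrightarrow> (\<integral>\<omega>. indicator A \<omega> * Z x \<omega> \<partial>M)"
    proof (rule integral_dominated_convergence[OF _ _ d_int])
      show "AE \<omega> in M. (\<lambda>i. indicator A \<omega> * Z (s i) \<omega>) \<longlonglongrightarrow> indicator A \<omega> * Z x \<omega>"
        unfolding Z_def using s(2) subalg
        by (intro AE_I2 tendsto_intros) (auto simp: subalgebra_def)
      show "AE \<omega> in M. norm (indicator A \<omega> * Z (s i) \<omega>) \<le> norm (d \<omega>)" for i
        using Z_bound[of "s i"] by (auto simp: indicator_def)
      show "(\<lambda>\<omega>. indicator A \<omega> * Z x \<omega>) \<in> borel_measurable M"
        "(\<lambda>\<omega>. indicator A \<omega> * Z (s i) \<omega>) \<in> borel_measurable M" for i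
        by (intro borel_measurable_integrable ind_int A x strongly_measurable_simple s)+
    qed
    then show ?thesis
      by (rule LIMSEQ_le_const) (use simple[OF A s(1)] in auto)
  qed
  have \<rho>M[measurable]: "\<rho> \<in> borel_measurable M" by (rule measurable_from_subalg[OF subalg \<rho>(1)])
  have "integrable M (\<lambda>\<omega>. B * Z x \<omega>)" using Z_int[OF x] by simp
  then have int: "integrable M (\<lambda>\<omega>. \<rho> \<omega> * Z x \<omega>)"
  proof (rule Bochner_Integration.integrable_bound)
    show "(\<lambda>\<omega>. \<rho> \<omega> * Z x \<omega>) \<in> borel_measurable M"
      using Z_meas[OF x] by measurable
    show "AE \<omega> in M. norm (\<rho> \<omega> * Z x \<omega>) \<le> norm (B * Z x \<omega>)"
    proof (rule AE_I2)
      fix \<omega> assume "\<omega> \<in> space M"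
      then have "\<bar>\<rho> \<omega>\<bar> \<le> \<bar>B\<bar>" using \<rho>(2,3) by fastforce
      then show "norm (\<rho> \<omega> * Z x \<omega>) \<le> norm (B * Z x \<omega>)"
        by (simp add: abs_mult mult_right_mono)
    qed
  qed
  show "integrable M (\<lambda>\<omega>. \<rho> \<omega> * (norm (x \<omega> - (h \<omega> - g \<omega>)) - norm (x \<omega>)))"
    using int by (simp add: Z_def d_def)
  have "AE \<omega> in M. 0 \<le> real_cond_exp M F (Z x) \<omega>"
    by (rule real_cond_exp_nonneg_of_set_integrals[OF Z_int[OF x] sets])
  then have "0 \<le> (\<integral>\<omega>. \<rho> \<omega> * real_cond_exp M F (Z x) \<omega> \<partial>M)"
    using AE_space by (intro integral_nonneg_AE, eventually_elim) (simp add: \<rho>(2))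
  also have "\<dots> = (\<integral>\<omega>. \<rho> \<omega> * Z x \<omega> \<partial>M)"
    by (rule real_cond_exp_intg(2)[OF int \<rho>(1) Z_meas[OF x]])
  finally show "0 \<le> (\<integral>\<omega>. \<rho> \<omega> * (norm (x \<omega> - (h \<omega> - g \<omega>)) - norm (x \<omega>)) \<partial>M)"
    by (simp add: Z_def d_def)
qed

end

section \<open>Bounded weights: interaction with increments, and maximal inequality\<close>

primrec running_max :: "(nat \<Rightarrow> 'a \<Rightarrow> real) \<Rightarrow> nat \<Rightarrow> 'a \<Rightarrow> real" where
  "running_max h 0 \<omega> = h 0 \<omega>"
| "running_max h (Suc n) \<omega> = max (running_max h n \<omega>) (h (Suc n) \<omega>)"

lemma running_max_ge: "h n \<omega> \<le> running_max h n \<omega>"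
  by (cases n) auto

lemma running_max_mono: "m \<le> n \<Longrightarrow> running_max h m \<omega> \<le> running_max h n \<omega>"
  by (induction n rule: dec_induct) auto

lemma running_max_le: "(\<And>i. i \<le> n \<Longrightarrow> h i \<omega> \<le> c) \<Longrightarrow> running_max h n \<omega> \<le> c"
  by (induction n) auto

text \<open>With \<open>\<psi> m w = sqrt (w\<^sup>2 + m\<^sup>2)\<close> the bracket contains the second order remainder of the convex function \<open>\<psi> m\<close>
  between \<open>w\<close> and \<open>w'\<close>, enlarged by replacing \<open>m\<close> by the new maximum in the first term. That remainder
  controls the square of a martingale increment up to the new maximum, so that
  \<open>\<Sum> |\<Delta>w|\<^sup>2 / w\<^sup>*\<close> is bounded in conditional expectation by a multiple of \<open>w\<^sup>*\<close>. The linear growth of \<open>\<psi>\<close> is essential: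
  with \<open>w\<^sup>2 / m\<close> the jumps of \<open>w\<close> far beyond \<open>m\<close> would not be under control.\<close>

lemma max_sqrt_increment:
  fixes w m w' :: real
  assumes "0 \<le> w" "w \<le> m" "0 \<le> w'"
  shows "(w' - w)\<^sup>2 \<le> 4 * sqrt 2 * max m w' *
    (sqrt (w'\<^sup>2 + (max m w')\<^sup>2) - sqrt (w\<^sup>2 + m\<^sup>2) - w / sqrt (w\<^sup>2 + m\<^sup>2) * (w' - w))"
proof (cases "m = 0")
  case True
  have "sqrt (w'\<^sup>2 + w'\<^sup>2) = sqrt 2 * w'"
    using assms by (simp add: real_sqrt_mult flip: mult_2)
  moreover have "max m w' = w'" "w = 0" using True assms by auto
  moreover have "w' * w' \<le> 4 * sqrt 2 * w' * (sqrt 2 * w')"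
  proof -
    have "4 * sqrt 2 * w' * (sqrt 2 * w') = 4 * (sqrt 2 * sqrt 2) * (w' * w')"
      by (simp only: ac_simps)
    also have "\<dots> = 8 * (w' * w')" by simp
    finally have eq: "4 * sqrt 2 * w' * (sqrt 2 * w') = 8 * (w' * w')" .
    show ?thesis unfolding eq by simp
  qed
  ultimately show ?thesis
    using True by (simp add: power2_eq_square)
next
  case False
  then have m: "0 < m" using assms by simp
  define m' where "m' = max m w'"
  define A where "A = sqrt (w'\<^sup>2 + m\<^sup>2)"
  define B where "B = sqrt (w\<^sup>2 + m\<^sup>2)"
  define t where "t = w * w' + m\<^sup>2"
  have "0 < w\<^sup>2 + m\<^sup>2" "0 < w'\<^sup>2 + m\<^sup>2"
    using m by (simp_all add: add_nonneg_pos)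
  then have B: "0 < B" "B\<^sup>2 = w\<^sup>2 + m\<^sup>2" and A: "0 < A" "A\<^sup>2 = w'\<^sup>2 + m\<^sup>2"
    by (simp_all add: A_def B_def)
  have sq: "(A * B)\<^sup>2 - t\<^sup>2 = m\<^sup>2 * (w' - w)\<^sup>2"
    unfolding power_mult_distrib[of A B] A(2) B(2) t_def by algebra
  moreover have "0 \<le> m\<^sup>2 * (w' - w)\<^sup>2" by simp
  ultimately have "t\<^sup>2 \<le> (A * B)\<^sup>2" by linarith
  then have tle: "t \<le> A * B"
    by (rule power2_le_imp_le) (simp add: A(1) B(1) less_imp_le)
  define D where "D = (A * B - t) / B"
  have D: "0 \<le> D" using tle B(1) by (simp add: D_def)
  have D_eq: "D = A - B - w / B * (w' - w)"
  proof -
    have "B * (A - B - w / B * (w' - w)) = A * B - B\<^sup>2 - w * (w' - w)"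
      using B(1) by (simp add: right_diff_distrib power2_eq_square)
    also have "\<dots> = A * B - t" unfolding B(2) t_def by algebra
    finally have "B * (A - B - w / B * (w' - w)) / B = D" by (simp only: D_def)
    then show ?thesis using B(1) by simp
  qed
  have "m\<^sup>2 * (w' - w)\<^sup>2 = (A * B - t) * (A * B + t)"
    unfolding sq[symmetric] by algebra
  also have "\<dots> \<le> (A * B - t) * (2 * (A * B))"
    using tle by (intro mult_left_mono) auto
  also have "\<dots> = 2 * A * D * B\<^sup>2"
    using B(1) by (simp add: D_def power2_eq_square)
  also have "\<dots> \<le> 2 * A * D * (2 * m\<^sup>2)"
  proof (intro mult_left_mono)
    show "B\<^sup>2 \<le> 2 * m\<^sup>2" unfolding B(2) using assms by (simp add: power_mono)
  qed (use A(1) D in auto)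
  also have "\<dots> = m\<^sup>2 * (4 * A * D)" by algebra
  finally have "m\<^sup>2 * (w' - w)\<^sup>2 \<le> m\<^sup>2 * (4 * A * D)" .
  then have "(w' - w)\<^sup>2 \<le> 4 * A * D" using m by (simp add: mult_le_cancel_left_pos)
  also have "\<dots> \<le> 4 * (sqrt 2 * m') * D"
  proof -
    have "A \<le> sqrt (m'\<^sup>2 + m'\<^sup>2)"
      unfolding A_def using m assms
      by (intro real_sqrt_le_mono add_mono power_mono) (auto simp: m'_def)
    also have "\<dots> = sqrt 2 * m'"
    proof -
      have "0 \<le> m'" using m by (simp add: m'_def le_max_iff_disj)
      then show ?thesis by (simp add: real_sqrt_mult flip: mult_2)
    qed
    finally show ?thesis using D by (intro mult_right_mono mult_left_mono) auto
  qed
  also have "\<dots> \<le> 4 * (sqrt 2 * m') * (sqrt (w'\<^sup>2 + m'\<^sup>2) - B - w / B * (w' - w))"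
  proof (intro mult_left_mono)
    have "A \<le> sqrt (w'\<^sup>2 + m'\<^sup>2)"
      unfolding A_def using m assms by (intro real_sqrt_le_mono add_mono power_mono) (auto simp: m'_def)
    then show "D \<le> sqrt (w'\<^sup>2 + m'\<^sup>2) - B - w / B * (w' - w)"
      unfolding D_eq by linarith
  qed (use m in \<open>auto simp: m'_def\<close>)
  finally show ?thesis by (simp add: m'_def B_def mult.assoc)
qed

text \<open>The second summand produces the square of the increment of the weight, by the previous lemma; the
  first one absorbs the errors that are multiples of \<open>m\<close> times an increment of \<open>s\<close>.\<close>

definition cross_potential :: "real \<Rightarrow> real \<Rightarrow> real \<Rightarrow> real" where
  "cross_potential s w m = 3 / 2 * (s * m) + 2 * sqrt 2 * (s * sqrt (w\<^sup>2 + m\<^sup>2))"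

lemma cross_potential_le:
  assumes "0 \<le> s" "0 \<le> w" "w \<le> m"
  shows "cross_potential s w m \<le> 11 / 2 * (s * m)" "0 \<le> cross_potential s w m"
proof -
  have "sqrt (w\<^sup>2 + m\<^sup>2) \<le> sqrt (m\<^sup>2 + m\<^sup>2)"
    using assms by (intro real_sqrt_le_mono add_mono power_mono) auto
  also have "\<dots> = sqrt 2 * m" using assms by (simp add: real_sqrt_mult flip: mult_2)
  finally have "2 * sqrt 2 * (s * sqrt (w\<^sup>2 + m\<^sup>2)) \<le> 2 * sqrt 2 * (s * (sqrt 2 * m))"
    using assms by (intro mult_left_mono) auto
  also have "2 * sqrt 2 * (s * (sqrt 2 * m)) = 2 * (sqrt 2 * sqrt 2) * (s * m)"
    by (simp only: ac_simps)
  finally show "cross_potential s w m \<le> 11 / 2 * (s * m)"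
    by (simp add: cross_potential_def)
  show "0 \<le> cross_potential s w m" using assms by (simp add: cross_potential_def)
qed

text \<open>One step of the estimate of \<open>\<Sum> d |\<Delta>w|\<close>. It splits \<open>d |\<Delta>w|\<close> by the inequality of arithmetic and geometric means
  into \<open>d\<^sup>2 m' / s'\<close>, which is at most \<open>2 m' (s' - s)\<close>, and \<open>s' |\<Delta>w|\<^sup>2 / m'\<close>. In the latter \<open>s'\<close>, which
  depends on the next step, is replaced by \<open>s\<close> at the cost of \<open>(s' - s) m'\<close>, as \<open>|\<Delta>w| \<le> m'\<close>. The last
  term on the right has mean zero.\<close>

lemma cross_potential_step:
  fixes s s' d w w' m :: real
  assumes s: "0 \<le> s" "s \<le> s'" and d: "0 \<le> d" "d\<^sup>2 \<le> 2 * s' * (s' - s)"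
    and w: "0 \<le> w" "w \<le> m" "0 \<le> w'"
  shows "d * \<bar>w' - w\<bar> \<le> cross_potential s' w' (max m w') - cross_potential s w m
     - 2 * sqrt 2 * (s * (w / sqrt (w\<^sup>2 + m\<^sup>2)) * (w' - w))"
proof -
  define m' where "m' = max m w'"
  define e where "e = \<bar>w' - w\<bar>"
  define \<Psi> where "\<Psi> = sqrt (w\<^sup>2 + m\<^sup>2)"
  define \<Psi>' where "\<Psi>' = sqrt (w'\<^sup>2 + m'\<^sup>2)"
  define D where "D = \<Psi>' - \<Psi> - w / \<Psi> * (w' - w)"
  have m': "0 \<le> m" "m \<le> m'" "0 \<le> m'" and e: "0 \<le> e" "e \<le> m'" using w by (auto simp: m'_def e_def)
  have e2: "e\<^sup>2 \<le> 4 * sqrt 2 * m' * D"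
    using max_sqrt_increment[OF w] by (simp add: m'_def e_def \<Psi>_def \<Psi>'_def D_def)
  have key: "d * e \<le> 3 / 2 * ((s' - s) * m') + 2 * sqrt 2 * (s * D)"
  proof (cases "m' = 0 \<or> s' = 0")
    case True
    then have "d * e = 0"
      using d e by auto
    moreover have "0 \<le> D \<or> s = 0"
    proof (cases "m' = 0")
      case True
      then have "w' = 0" "w = 0" "m = 0" using w m' by (auto simp: m'_def)
      then show ?thesis by (simp add: D_def \<Psi>_def \<Psi>'_def True)
    qed (use True s in auto)
    ultimately show ?thesis using s m' by auto
  next
    case False
    then have pos: "0 < m'" "0 < s'" using m' s by auto
    have D0: "0 \<le> D"
    proof -
      have "0 \<le> 4 * sqrt 2 * m' * D" using e2 zero_le_power2[of e] by linarith
      moreover have "0 < 4 * sqrt 2 * m'" using pos by simp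
      ultimately show ?thesis by (simp only: zero_le_mult_iff) linarith
    qed
    have "2 * (d * m') * (s' * e) \<le> (d * m')\<^sup>2 + (s' * e)\<^sup>2"
      by (rule sum_squares_bound)
    also have "\<dots> = d\<^sup>2 * m'\<^sup>2 + s'\<^sup>2 * e\<^sup>2" by (simp add: power_mult_distrib)
    also have "\<dots> \<le> (2 * s' * (s' - s)) * m'\<^sup>2 + s'\<^sup>2 * e\<^sup>2"
      using d by (intro add_mono mult_right_mono) auto
    also have "s'\<^sup>2 * e\<^sup>2 = s' * ((s' - s) * e\<^sup>2 + s * e\<^sup>2)"
      by (simp add: power2_eq_square algebra_simps)
    also have "\<dots> \<le> s' * ((s' - s) * m'\<^sup>2 + s * (4 * sqrt 2 * m' * D))"
      using s e e2 by (intro mult_left_mono add_mono power_mono) auto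
    finally have "2 * (d * m') * (s' * e) \<le>
      (2 * s' * (s' - s)) * m'\<^sup>2 + s' * ((s' - s) * m'\<^sup>2 + s * (4 * sqrt 2 * m' * D))" by simp
    then have "(2 * (s' * m')) * (d * e) \<le> (2 * (s' * m')) * (3 / 2 * ((s' - s) * m') + 2 * sqrt 2 * (s * D))"
      unfolding power2_eq_square by argo
    then show ?thesis using pos by (simp add: mult_le_cancel_left_pos)
  qed
  have "(s' - s) * m' \<le> s' * m' - s * m"
    using mult_left_mono[OF m'(2) s(1)] by (simp add: algebra_simps)
  then have 1: "3 / 2 * ((s' - s) * m') \<le> 3 / 2 * (s' * m' - s * m)"
    by (intro mult_left_mono) auto
  have "s * D \<le> s' * \<Psi>' - s * \<Psi> - s * (w / \<Psi>) * (w' - w)"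
    using mult_right_mono[OF s(2), of \<Psi>'] by (simp add: D_def \<Psi>'_def algebra_simps)
  then have 2: "2 * sqrt 2 * (s * D) \<le> 2 * sqrt 2 * (s' * \<Psi>' - s * \<Psi> - s * (w / \<Psi>) * (w' - w))"
    by (intro mult_left_mono) auto
  have "d * e \<le> 3 / 2 * (s' * m' - s * m) + 2 * sqrt 2 * (s' * \<Psi>' - s * \<Psi> - s * (w / \<Psi>) * (w' - w))"
    by (rule order_trans[OF key add_mono[OF 1 2]])
  also have "\<dots> = cross_potential s' w' m' - cross_potential s w m - 2 * sqrt 2 * (s * (w / \<Psi>) * (w' - w))"
    unfolding cross_potential_def \<Psi>_def[symmetric] \<Psi>'_def[symmetric]
    by (simp only: right_diff_distrib)
  finally show ?thesis
    by (simp only: e_def m'_def \<Psi>_def)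
qed

text \<open>The martingale \<open>W\<^sub>n = E(w | F\<^sub>n)\<close> of a bounded weight, through its defining property only, and with the
  bounds \<open>0 \<le> W\<^sub>n \<le> k\<close> everywhere instead of almost everywhere.\<close>

locale bounded_weight = finite_measure M for M :: "'a measure" +
  fixes F :: "nat \<Rightarrow> 'a measure" and w :: "'a \<Rightarrow> real" and W :: "nat \<Rightarrow> 'a \<Rightarrow> real" and k :: real
  assumes subalg: "\<And>n. subalgebra M (F n)"
    and F_mono: "\<And>m n. m \<le> n \<Longrightarrow> sets (F m) \<subseteq> sets (F n)"
    and W_meas: "\<And>n. W n \<in> borel_measurable (F n)"
    and W_nonneg: "\<And>n \<omega>. 0 \<le> W n \<omega>"
    and W_le: "\<And>n \<omega>. W n \<omega> \<le> k"
    and w_meas [measurable]: "w \<in> borel_measurable M"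
    and w_nonneg: "\<And>\<omega>. \<omega> \<in> space M \<Longrightarrow> 0 \<le> w \<omega>"
    and w_le: "\<And>\<omega>. \<omega> \<in> space M \<Longrightarrow> w \<omega> \<le> k"
    and W_cond: "\<And>n Z. Z \<in> borel_measurable (F n) \<Longrightarrow> integrable M Z \<Longrightarrow>
          (\<integral>\<omega>. Z \<omega> * W n \<omega> \<partial>M) = (\<integral>\<omega>. Z \<omega> * w \<omega> \<partial>M)"
begin

lemma space_F: "space (F n) = space M"
  using subalg by (simp add: subalgebra_def)

lemma F_measurable_mono: "h \<in> borel_measurable (F m) \<Longrightarrow> m \<le> n \<Longrightarrow> h \<in> borel_measurable (F n)"
  by (rule borel_measurable_subalgebra[OF F_mono]) (simp_all only: space_F)

lemma W_martingale:
  assumes "Z \<in> borel_measurable (F n)" "integrable M Z"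
  shows "(\<integral>\<omega>. Z \<omega> * W (Suc n) \<omega> \<partial>M) = (\<integral>\<omega>. Z \<omega> * W n \<omega> \<partial>M)"
  using W_cond[OF F_measurable_mono[OF assms(1), of "Suc n"] assms(2)] W_cond[OF assms] by simp

lemma F_measurable_M: "h \<in> borel_measurable (F m) \<Longrightarrow> h \<in> borel_measurable M"
  by (rule measurable_from_subalg[OF subalg])

lemma running_max_meas:
  assumes "\<And>n. h n \<in> borel_measurable (F n)"
  shows "running_max h n \<in> borel_measurable (F n)"
proof (induction n)
  case 0
  have "running_max h 0 = h 0" by (rule ext) simp
  then show ?case using assms by simp
next
  case (Suc n)
  have "running_max h (Suc n) = (\<lambda>\<omega>. max (running_max h n \<omega>) (h (Suc n) \<omega>))" by (rule ext) simp
  then show ?case using F_measurable_mono[OF Suc, of "Suc n"] assms by simp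
qed

lemma W_measM [measurable]: "W n \<in> borel_measurable M"
  by (rule F_measurable_M[OF W_meas])

lemma running_maxW_measM [measurable]: "running_max W n \<in> borel_measurable M"
  by (rule F_measurable_M[OF running_max_meas[OF W_meas]])

lemma running_maxW_nonneg: "0 \<le> running_max W n \<omega>"
  using running_max_ge[of W n \<omega>] W_nonneg[of n \<omega>] by linarith

lemma running_maxW_le: "running_max W n \<omega> \<le> k"
  by (rule running_max_le) (rule W_le)

lemma integrable_mult_bounded:
  assumes "integrable M h" "b \<in> borel_measurable M" "\<And>\<omega>. \<omega> \<in> space M \<Longrightarrow> \<bar>b \<omega>\<bar> \<le> c"
  shows "integrable M (\<lambda>\<omega>. h \<omega> * b \<omega> :: real)"
proof (rule Bochner_Integration.integrable_bound)
  show "integrable M (\<lambda>\<omega>. h \<omega> * c)" using assms by simp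
  show "(\<lambda>\<omega>. h \<omega> * b \<omega>) \<in> borel_measurable M" using assms by measurable
  have "\<bar>b \<omega>\<bar> \<le> \<bar>c\<bar>" if "\<omega> \<in> space M" for \<omega> using assms(3)[OF that] by linarith
  then show "AE \<omega> in M. norm (h \<omega> * b \<omega>) \<le> norm (h \<omega> * c)"
    by (intro AE_I2) (simp add: abs_mult mult_left_mono)
qed

lemma integrable_mult_W: "integrable M h \<Longrightarrow> integrable M (\<lambda>\<omega>. h \<omega> * W n \<omega>)"
  by (rule integrable_mult_bounded[where c = k]) (auto simp: W_nonneg W_le)

lemma integrable_mult_w: "integrable M h \<Longrightarrow> integrable M (\<lambda>\<omega>. h \<omega> * w \<omega>)"
  by (rule integrable_mult_bounded[where c = k]) (auto simp: w_nonneg w_le)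

lemma integrable_mult_running_maxW: "integrable M h \<Longrightarrow> integrable M (\<lambda>\<omega>. h \<omega> * running_max W n \<omega>)"
  by (rule integrable_mult_bounded[where c = k]) (auto simp: running_maxW_nonneg running_maxW_le)

text \<open>The weight and the process \<open>f\<close> move at the same time, and this lemma bounds their interaction.
  It is Fefferman's \<open>H\<^sup>1\<close>-\<open>BMO\<close> argument with \<open>w\<^sup>*\<close> in the place of a \<open>BMO\<close> norm; only the sizes \<open>d\<^sub>n\<close> of the
  increments enter, hence it is a statement about real numbers.\<close>

lemma cross_variation_le:
  fixes S d :: "nat \<Rightarrow> 'a \<Rightarrow> real"
  assumes S_meas: "\<And>n. S n \<in> borel_measurable (F n)" and S_int: "\<And>n. integrable M (S n)"
    and d_int: "\<And>n. integrable M (d n)"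
    and S0: "\<And>\<omega>. 0 \<le> S 0 \<omega>" and S_mono: "\<And>n \<omega>. S n \<omega> \<le> S (Suc n) \<omega>"
    and d: "\<And>n \<omega>. 0 \<le> d n \<omega>" "\<And>n \<omega>. (d n \<omega>)\<^sup>2 \<le> 2 * S (Suc n) \<omega> * (S (Suc n) \<omega> - S n \<omega>)"
  shows "(\<integral>\<omega>. (\<Sum>n<N. d n \<omega> * \<bar>W (Suc n) \<omega> - W n \<omega>\<bar>) \<partial>M) \<le> 11 / 2 * (\<integral>\<omega>. S N \<omega> * running_max W N \<omega> \<partial>M)"
proof -
  define H where "H = (\<lambda>n \<omega>. cross_potential (S n \<omega>) (W n \<omega>) (running_max W n \<omega>))"
  define c where "c = (\<lambda>n \<omega>. W n \<omega> / sqrt ((W n \<omega>)\<^sup>2 + (running_max W n \<omega>)\<^sup>2))"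
  define X where "X = (\<lambda>n \<omega>. d n \<omega> * \<bar>W (Suc n) \<omega> - W n \<omega>\<bar>)"
  note [measurable] = W_meas running_max_meas[OF W_meas] S_meas F_measurable_M[OF S_meas]
  have S_nonneg: "0 \<le> S n \<omega>" for n \<omega>
  proof (induction n)
    case (Suc n)
    then show ?case using S_mono[of n \<omega>] by linarith
  qed (rule S0)
  have H_le: "0 \<le> H n \<omega>" "H n \<omega> \<le> 11 / 2 * (S n \<omega> * running_max W n \<omega>)" for n \<omega>
    unfolding H_def by (intro cross_potential_le S_nonneg W_nonneg running_max_ge)+
  have H_meas: "H n \<in> borel_measurable M" for n
    unfolding H_def cross_potential_def by measurable
  have H_int: "integrable M (H n)" for n
  proof (rule Bochner_Integration.integrable_bound)
    show "integrable M (\<lambda>\<omega>. 11 / 2 * (S n \<omega> * running_max W n \<omega>))"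
      by (intro integrable_mult_right integrable_mult_running_maxW S_int)
    show "AE \<omega> in M. norm (H n \<omega>) \<le> norm (11 / 2 * (S n \<omega> * running_max W n \<omega>))"
    proof (rule AE_I2)
      fix \<omega>
      have "norm (H n \<omega>) = H n \<omega>" using H_le(1) by simp
      also have "\<dots> \<le> norm (11 / 2 * (S n \<omega> * running_max W n \<omega>))"
        by (rule order_trans[OF H_le(2)]) simp
      finally show "norm (H n \<omega>) \<le> norm (11 / 2 * (S n \<omega> * running_max W n \<omega>))" .
    qed
  qed (rule H_meas)
  have c_bound: "\<bar>c n \<omega>\<bar> \<le> 1" for n \<omega>
  proof -
    have "W n \<omega> \<le> sqrt ((W n \<omega>)\<^sup>2 + (running_max W n \<omega>)\<^sup>2)"
      by (rule real_le_rsqrt) simp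
    then show ?thesis
      unfolding c_def using W_nonneg[of n \<omega>] by (auto simp: divide_le_eq_1 less_le)
  qed
  have Sc_int: "integrable M (\<lambda>\<omega>. S n \<omega> * c n \<omega>)" for n
    by (rule integrable_mult_bounded[where c = 1]) (auto simp: S_int c_bound, simp add: c_def)
  have Sc: "(\<integral>\<omega>. S n \<omega> * c n \<omega> * (W (Suc n) \<omega> - W n \<omega>) \<partial>M) = 0"
    "integrable M (\<lambda>\<omega>. S n \<omega> * c n \<omega> * (W (Suc n) \<omega> - W n \<omega>))" for n
  proof -
    have "(\<lambda>\<omega>. S n \<omega> * c n \<omega>) \<in> borel_measurable (F n)" unfolding c_def by measurable
    then have "(\<integral>\<omega>. S n \<omega> * c n \<omega> * W (Suc n) \<omega> \<partial>M) = (\<integral>\<omega>. S n \<omega> * c n \<omega> * W n \<omega> \<partial>M)"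
      by (rule W_martingale) (rule Sc_int)
    then show "(\<integral>\<omega>. S n \<omega> * c n \<omega> * (W (Suc n) \<omega> - W n \<omega>) \<partial>M) = 0"
      by (simp add: right_diff_distrib Bochner_Integration.integral_diff integrable_mult_W[OF Sc_int])
    show "integrable M (\<lambda>\<omega>. S n \<omega> * c n \<omega> * (W (Suc n) \<omega> - W n \<omega>))"
      by (simp add: right_diff_distrib integrable_mult_W[OF Sc_int])
  qed
  have X_int: "integrable M (X n)" for n
    unfolding X_def
  proof (rule integrable_mult_bounded[where c = k])
    show "\<bar>\<bar>W (Suc n) \<omega> - W n \<omega>\<bar>\<bar> \<le> k" for \<omega>
      using W_nonneg[of n \<omega>] W_nonneg[of "Suc n" \<omega>] W_le[of n \<omega>] W_le[of "Suc n" \<omega>] by linarith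
  qed (auto simp: d_int)
  have step: "(\<integral>\<omega>. X n \<omega> \<partial>M) \<le> (\<integral>\<omega>. H (Suc n) \<omega> \<partial>M) - (\<integral>\<omega>. H n \<omega> \<partial>M)" for n
  proof -
    have "(\<integral>\<omega>. X n \<omega> \<partial>M) \<le> (\<integral>\<omega>. H (Suc n) \<omega> - H n \<omega>
        - 2 * sqrt 2 * (S n \<omega> * c n \<omega> * (W (Suc n) \<omega> - W n \<omega>)) \<partial>M)"
    proof (rule integral_mono)
      fix \<omega> show "X n \<omega> \<le> H (Suc n) \<omega> - H n \<omega> - 2 * sqrt 2 * (S n \<omega> * c n \<omega> * (W (Suc n) \<omega> - W n \<omega>))"
        unfolding X_def H_def c_def running_max.simps
        by (rule cross_potential_step) (auto simp: S_nonneg S_mono d W_nonneg running_max_ge)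
    qed (intro X_int Bochner_Integration.integrable_diff H_int integrable_mult_right Sc)+
    also have "\<dots> = (\<integral>\<omega>. H (Suc n) \<omega> \<partial>M) - (\<integral>\<omega>. H n \<omega> \<partial>M)
        - (\<integral>\<omega>. 2 * sqrt 2 * (S n \<omega> * c n \<omega> * (W (Suc n) \<omega> - W n \<omega>)) \<partial>M)"
      using H_int Sc(2) by (simp add: Bochner_Integration.integral_diff)
    also have "(\<integral>\<omega>. 2 * sqrt 2 * (S n \<omega> * c n \<omega> * (W (Suc n) \<omega> - W n \<omega>)) \<partial>M) = 0"
      using Sc(1) by simp
    finally show ?thesis by simp
  qed
  have "(\<integral>\<omega>. (\<Sum>n<N. X n \<omega>) \<partial>M) = (\<Sum>n<N. \<integral>\<omega>. X n \<omega> \<partial>M)"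
    by (intro Bochner_Integration.integral_sum X_int)
  also have "\<dots> \<le> (\<Sum>n<N. (\<integral>\<omega>. H (Suc n) \<omega> \<partial>M) - (\<integral>\<omega>. H n \<omega> \<partial>M))"
    by (intro sum_mono step)
  also have "\<dots> = (\<integral>\<omega>. H N \<omega> \<partial>M) - (\<integral>\<omega>. H 0 \<omega> \<partial>M)"
    by (rule sum_lessThan_telescope)
  also have "\<dots> \<le> (\<integral>\<omega>. H N \<omega> \<partial>M)"
    using H_le(1) by simp
  also have "\<dots> \<le> (\<integral>\<omega>. 11 / 2 * (S N \<omega> * running_max W N \<omega>) \<partial>M)"
    by (intro integral_mono H_int integrable_mult_right integrable_mult_running_maxW S_int H_le)
  finally show ?thesis by (simp add: X_def)
qed

lemma powr_tangent:
  fixes a b q :: real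
  assumes "1 < q" "0 \<le> a" "0 \<le> b"
  shows "q * (a powr (q - 1) * b) \<le> (q - 1) * a powr q + b powr q"
proof -
  define r where "r = q / (q - 1)"
  have r: "1 < r" "1 / r + 1 / q = 1" "(q - 1) * r = q" "q / r = q - 1"
    using assms by (auto simp: r_def field_simps)
  have "a powr (q - 1) * b \<le> (a powr (q - 1)) powr r / r + b powr q / q"
    by (rule Youngs_inequality) (use assms r in auto)
  then have "q * (a powr (q - 1) * b) \<le> q * (a powr q / r + b powr q / q)"
    using assms r by (intro mult_left_mono) (auto simp: powr_powr)
  also have "\<dots> = q / r * a powr q + b powr q"
    using assms by (simp add: distrib_left)
  finally show ?thesis by (simp only: r(4))
qed

text \<open>Doob's maximal inequality by the same method: for the running maximum \<open>m\<close> of \<open>W\<close>, the process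
  \<open>(q - 1) m\<^sub>n^q - q m\<^sub>n^(q - 1) W\<^sub>n\<close> is a supermartingale, because at a new record the tangent of \<open>x^q\<close> at
  the old maximum lies below the curve.\<close>

lemma Doob_running_max:
  assumes q: "1 < q" and r: "1 / q + 1 / r = 1"
  shows "(\<integral>\<omega>. running_max W N \<omega> powr q \<partial>M) \<le> r powr q * (\<integral>\<omega>. w \<omega> powr q \<partial>M)"
proof -
  have r1: "1 < r" by (rule conjugate_exponent_gt_1[OF q r])
  have qr: "(q - 1) * r = q" using q r r1 by (simp add: field_simps)
  define m where "m = running_max W"
  define H where "H = (\<lambda>n \<omega>. (q - 1) * m n \<omega> powr q - q * (m n \<omega> powr (q - 1) * W n \<omega>))"
  have m_meas: "m n \<in> borel_measurable (F n)" for n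
    unfolding m_def by (rule running_max_meas[OF W_meas])
  have mM [measurable]: "m n \<in> borel_measurable M" for n by (rule F_measurable_M[OF m_meas])
  have m: "0 \<le> m n \<omega>" "m n \<omega> \<le> k" "W n \<omega> \<le> m n \<omega>" for n \<omega>
    by (simp_all add: m_def running_maxW_nonneg running_maxW_le running_max_ge)
  have powr_int: "integrable M (\<lambda>\<omega>. m n \<omega> powr c)" if "0 \<le> c" for n c
  proof (rule Bochner_Integration.integrable_bound)
    show "integrable M (\<lambda>\<omega>. k powr c)" by simp
    show "AE \<omega> in M. norm (m n \<omega> powr c) \<le> norm (k powr c)"
      using m that by (intro AE_I2) (simp add: powr_mono2)
  qed measurable
  have w_int: "integrable M (\<lambda>\<omega>. w \<omega> powr q)"
  proof (rule Bochner_Integration.integrable_bound)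
    show "integrable M (\<lambda>\<omega>. k powr q)" by simp
    show "AE \<omega> in M. norm (w \<omega> powr q) \<le> norm (k powr q)"
      using w_nonneg w_le q by (intro AE_I2) (simp add: powr_mono2)
  qed measurable
  have prod_int: "integrable M (\<lambda>\<omega>. m n \<omega> powr (q - 1) * W i \<omega>)" for n i
    using q by (intro integrable_mult_W powr_int) simp
  have H_int: "integrable M (H n)" for n
    unfolding H_def using q by (intro Bochner_Integration.integrable_diff integrable_mult_right powr_int prod_int) simp
  have H_le_0: "(\<integral>\<omega>. H n \<omega> \<partial>M) \<le> 0" for n
  proof (induction n)
    case 0
    have "H 0 \<omega> \<le> 0" for \<omega>
    proof -
      have "m 0 \<omega> = W 0 \<omega>" by (simp add: m_def)
      then have "m 0 \<omega> powr (q - 1) * W 0 \<omega> = m 0 \<omega> powr q"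
        using m(1)[of 0 \<omega>] powr_mult_base[of "m 0 \<omega>" "q - 1"] by (simp add: mult.commute)
      then show ?thesis by (simp add: H_def left_diff_distrib)
    qed
    then show ?case using integral_mono[of M "H 0" "\<lambda>_. 0"] H_int[of 0] by simp
  next
    case (Suc n)
    have le: "H (Suc n) \<omega> \<le> (q - 1) * m n \<omega> powr q - q * (m n \<omega> powr (q - 1) * W (Suc n) \<omega>)" for \<omega>
    proof (cases "W (Suc n) \<omega> \<le> m n \<omega>")
      case True
      then have "m (Suc n) \<omega> = m n \<omega>" by (simp add: m_def)
      then show ?thesis by (simp add: H_def)
    next
      case False
      then have eq: "m (Suc n) \<omega> = W (Suc n) \<omega>" by (simp add: m_def)
      then have "m (Suc n) \<omega> powr (q - 1) * W (Suc n) \<omega> = W (Suc n) \<omega> powr q"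
        using W_nonneg[of "Suc n" \<omega>] powr_mult_base[of "W (Suc n) \<omega>" "q - 1"] by (simp add: mult.commute)
      then have "H (Suc n) \<omega> = - (W (Suc n) \<omega> powr q)"
        by (simp add: H_def eq left_diff_distrib)
      then show ?thesis
        using powr_tangent[OF q m(1)[of n \<omega>] W_nonneg[of "Suc n" \<omega>]] by linarith
    qed
    have "(\<integral>\<omega>. H (Suc n) \<omega> \<partial>M)
        \<le> (\<integral>\<omega>. (q - 1) * m n \<omega> powr q - q * (m n \<omega> powr (q - 1) * W (Suc n) \<omega>) \<partial>M)"
      using q by (intro integral_mono le H_int Bochner_Integration.integrable_diff integrable_mult_right powr_int prod_int) simp
    also have "\<dots> = (\<integral>\<omega>. (q - 1) * m n \<omega> powr q \<partial>M) - q * (\<integral>\<omega>. m n \<omega> powr (q - 1) * W (Suc n) \<omega> \<partial>M)"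
      using q powr_int[of q n] prod_int[of n "Suc n"] by (simp add: Bochner_Integration.integral_diff)
    also have "(\<integral>\<omega>. m n \<omega> powr (q - 1) * W (Suc n) \<omega> \<partial>M) = (\<integral>\<omega>. m n \<omega> powr (q - 1) * W n \<omega> \<partial>M)"
    proof (rule W_martingale)
      show "(\<lambda>\<omega>. m n \<omega> powr (q - 1)) \<in> borel_measurable (F n)" using m_meas[of n] by measurable
    qed (use q powr_int in simp)
    also have "(\<integral>\<omega>. (q - 1) * m n \<omega> powr q \<partial>M) - q * \<dots> = (\<integral>\<omega>. H n \<omega> \<partial>M)"
      using q powr_int[of q n] prod_int[of n n] by (simp add: H_def Bochner_Integration.integral_diff)
    finally show ?case using Suc by linarith
  qed
  have "(q - 1) * (\<integral>\<omega>. m N \<omega> powr q \<partial>M) \<le> q * (\<integral>\<omega>. m N \<omega> powr (q - 1) * W N \<omega> \<partial>M)"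
    using H_le_0[of N] q powr_int[of q N] prod_int[of N N] by (simp add: H_def Bochner_Integration.integral_diff)
  also have "(\<integral>\<omega>. m N \<omega> powr (q - 1) * W N \<omega> \<partial>M) = (\<integral>\<omega>. m N \<omega> powr (q - 1) * w \<omega> \<partial>M)"
  proof (rule W_cond)
    show "(\<lambda>\<omega>. m N \<omega> powr (q - 1)) \<in> borel_measurable (F N)" using m_meas[of N] by measurable
  qed (use q powr_int in simp)
  finally have 1: "(q - 1) * (\<integral>\<omega>. m N \<omega> powr q \<partial>M) \<le> q * (\<integral>\<omega>. m N \<omega> powr (q - 1) * w \<omega> \<partial>M)" .
  have young: "r * (m N \<omega> powr (q - 1) * w \<omega>) \<le> m N \<omega> powr q / r + r powr q * w \<omega> powr q / q"
    if "\<omega> \<in> space M" for \<omega>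
  proof -
    have "m N \<omega> powr (q - 1) * (r * w \<omega>) \<le> (m N \<omega> powr (q - 1)) powr r / r + (r * w \<omega>) powr q / q"
      by (rule Youngs_inequality) (use q r r1 w_nonneg[OF that] in auto)
    then show ?thesis
      using r1 w_nonneg[OF that] by (simp add: powr_powr qr powr_mult mult.left_commute)
  qed
  have wprod: "integrable M (\<lambda>\<omega>. m N \<omega> powr (q - 1) * w \<omega>)"
    using q by (intro integrable_mult_w powr_int) simp
  have "r * (\<integral>\<omega>. m N \<omega> powr (q - 1) * w \<omega> \<partial>M) = (\<integral>\<omega>. r * (m N \<omega> powr (q - 1) * w \<omega>) \<partial>M)"
    by simp
  also have "\<dots> \<le> (\<integral>\<omega>. m N \<omega> powr q / r + r powr q * w \<omega> powr q / q \<partial>M)"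
    using q by (intro integral_mono young integrable_mult_right wprod Bochner_Integration.integrable_add
        integrable_divide powr_int w_int) auto
  also have "\<dots> = (\<integral>\<omega>. m N \<omega> powr q \<partial>M) / r + r powr q * (\<integral>\<omega>. w \<omega> powr q \<partial>M) / q"
    using q powr_int[of q N] w_int by simp
  finally have 2: "r * (\<integral>\<omega>. m N \<omega> powr (q - 1) * w \<omega> \<partial>M)
      \<le> (\<integral>\<omega>. m N \<omega> powr q \<partial>M) / r + r powr q * (\<integral>\<omega>. w \<omega> powr q \<partial>M) / q" .
  define I where "I = (\<integral>\<omega>. m N \<omega> powr q \<partial>M)"
  define J where "J = (\<integral>\<omega>. m N \<omega> powr (q - 1) * w \<omega> \<partial>M)"
  define L where "L = r powr q * (\<integral>\<omega>. w \<omega> powr q \<partial>M)"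
  have "(q - 1) * I \<le> (q - 1) * (r * J)"
    using 1 qr by (simp add: I_def J_def mult.assoc[symmetric])
  then have "I \<le> r * J" using q by (simp add: mult_le_cancel_left_pos)
  also have "\<dots> \<le> I / r + L / q" using 2 by (simp add: I_def J_def L_def)
  finally have "I - I / r \<le> L / q" by simp
  moreover have "I - I / r = I / q"
  proof -
    have "I = I * (1 / q + 1 / r)" using r by simp
    also have "\<dots> = I / q + I / r" by (simp add: distrib_left)
    finally show ?thesis by simp
  qed
  ultimately have "I \<le> L" using q by (simp add: divide_le_cancel)
  then show ?thesis by (simp add: I_def L_def m_def)
qed

end

section \<open>The weighted inequality up to a finite time\<close>

text \<open>Either \<open>X\<close> is trivial or \<open>C \<ge> 1\<close>.\<close>

lemma smooth_banach_norm_le: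
  assumes "smooth_banach TYPE('x::banach) p C"
  shows "norm (d :: 'x) \<le> C * norm d"
proof (cases "norm d = 0")
  case False
  then have d: "0 < norm d" by simp
  have C: "0 < C" and p: "1 \<le> p"
    and sm: "(norm (0 + d) powr p + norm (0 - d) powr p) / 2 \<le> norm (0 :: 'x) powr p + C powr p * norm d powr p"
    using assms unfolding smooth_banach_def by blast+
  then have "norm d powr p \<le> (C * norm d) powr p"
    using d by (simp add: powr_mult)
  then show ?thesis
    using powr_less_mono2[of p "C * norm d" "norm d"] C d p by fastforce
qed simp

lemma max_potential_le:
  assumes "1 < p" "0 \<le> t" "0 \<le> y" "0 \<le> k"
  shows "max_potential p k t y \<le> k * t + y"
proof -
  have "k * pnorm p t y \<le> k * (t + y)"
    using pnorm_Lipschitz[of p 0 y t] assms by (intro mult_left_mono) auto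
  then show ?thesis by (simp add: max_potential_def algebra_simps)
qed

lemma max_potential_mono:
  assumes "0 < p" "0 \<le> s" "s \<le> t" "0 \<le> y" "0 \<le> k"
  shows "max_potential p k s y \<le> max_potential p k t y"
  unfolding max_potential_def using assms by (intro diff_right_mono mult_left_mono pnorm_mono) auto

text \<open>The pathwise core of the theorem, with \<open>x = f' n\<close>, \<open>d = g (n + 1) - g n\<close> and the weight moving from \<open>w\<close> to \<open>w'\<close>.
  Smoothness bounds the sum of the potentials at \<open>x + d\<close> and \<open>x - d\<close>, and convexity bounds the second
  one from below by its tangent at \<open>x\<close>. What remains is, in this order: the old potential, an error that
  telescopes, a term with a negative sign whose mean is nonnegative by Jensen's inequality, and the
  interaction of \<open>d\<close> with the increment of the weight.\<close>

lemma max_potential_step: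
  fixes x d :: "'x::banach"
  assumes sm: "smooth_banach TYPE('x) p C" and p: "1 < p" "1 / p + 1 / p' = 1" "0 \<le> p'"
    and y: "C * s \<le> y" and s: "0 \<le> s" and w: "0 \<le> w" "w \<le> m" and w': "0 \<le> w'" "w' \<le> m"
  defines "s' \<equiv> pnorm p s (norm d)"
    and "\<rho> \<equiv> (norm x / pnorm p (norm x) y) powr (p - 1)"
  shows "max_potential p (2 * p') (norm (x + d)) (max (max y (norm (x + d))) (C * s')) * w'
    \<le> max_potential p (2 * p') (norm x) y * w' + (4 * p' + 1) * C * ((s' - s) * m)
      - 2 * p' * (w * \<rho> * (norm (x - d) - norm x)) + 2 * p' * C * (norm d * \<bar>w' - w\<bar>)"
proof -
  have C: "0 < C" using sm by (simp add: smooth_banach_def)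
  have y0: "0 \<le> y" using y s C mult_nonneg_nonneg[of C s] by linarith
  have ss': "s \<le> s'" unfolding s'_def using le_pnorm(1)[of p s "norm d"] p s by simp
  define h where "h = pnorm p (norm x) y"
  define a where "a = pnorm p (norm (x + d)) y"
  define b where "b = pnorm p (norm (x - d)) y"
  define r where "r = \<rho> * (norm (x - d) - norm x)"
  define \<delta> where "\<delta> = C * (s' - s)"
  have \<delta>: "0 \<le> \<delta>" "\<delta> * w \<le> \<delta> * m" "\<delta> * w' \<le> \<delta> * m"
    using C ss' w w' by (auto simp: \<delta>_def intro!: mult_left_mono)
  have "a + b \<le> 2 * h + 2 * \<delta>"
    using pnorm_smooth[OF sm p(1) y s, of x d] by (simp add: a_def b_def h_def \<delta>_def s'_def)
  moreover have "h + r \<le> b"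
    using pnorm_tangent[of p "norm x" y "norm (x - d)"] p y0 by (simp add: b_def h_def r_def \<rho>_def)
  ultimately have ah: "a - h \<le> 2 * \<delta> - r" by linarith
  have "(a - h) * w \<le> (2 * \<delta> - r) * w"
    using ah w by (intro mult_right_mono) auto
  also have "\<dots> = 2 * (\<delta> * w) - w * r" by (simp add: algebra_simps)
  also have "\<dots> \<le> 2 * (\<delta> * m) - w * r" using \<delta> by simp
  finally have 1: "(a - h) * w \<le> 2 * (\<delta> * m) - w * r" .
  have "(a - h) * (w' - w) \<le> \<bar>a - h\<bar> * \<bar>w' - w\<bar>"
    by (metis abs_ge_self abs_mult)
  also have "\<dots> \<le> (C * norm d) * \<bar>w' - w\<bar>"
  proof (rule mult_right_mono)
    have "\<bar>a - h\<bar> \<le> \<bar>norm (x + d) - norm x\<bar>"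
      unfolding a_def h_def using p y0 by (intro pnorm_Lipschitz) auto
    also have "\<dots> \<le> norm d" using norm_triangle_ineq3[of "x + d" x] by simp
    also have "\<dots> \<le> C * norm d" by (rule smooth_banach_norm_le[OF sm])
    finally show "\<bar>a - h\<bar> \<le> C * norm d" .
  qed simp
  finally have 2: "(a - h) * (w' - w) \<le> C * (norm d * \<bar>w' - w\<bar>)" by (simp add: mult.assoc)
  have "(a - h) * w' = (a - h) * w + (a - h) * (w' - w)" by (simp add: algebra_simps)
  then have "(a - h) * w' \<le> 2 * (\<delta> * m) - w * r + C * (norm d * \<bar>w' - w\<bar>)"
    using 1 2 by linarith
  then have 3: "2 * p' * ((a - h) * w') \<le> 2 * p' * (2 * (\<delta> * m) - w * r + C * (norm d * \<bar>w' - w\<bar>))"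
    using p by (intro mult_left_mono) auto
  have "max_potential p (2 * p') (norm (x + d)) (max (max y (norm (x + d))) (C * s')) * w'
      \<le> (max_potential p (2 * p') (norm (x + d)) y + \<delta>) * w'"
    using max_potential_update[of p p' y "norm (x + d)" "C * s" "C * s'"] p y0 y C ss' w'
    by (intro mult_right_mono) (auto simp: \<delta>_def right_diff_distrib)
  also have "\<dots> = max_potential p (2 * p') (norm x) y * w' + 2 * p' * ((a - h) * w') + \<delta> * w'"
    by (simp add: max_potential_def a_def h_def algebra_simps)
  also have "\<dots> \<le> max_potential p (2 * p') (norm x) y * w'
      + 2 * p' * (2 * (\<delta> * m) - w * r + C * (norm d * \<bar>w' - w\<bar>)) + \<delta> * m"
    using 3 \<delta> by linarith
  also have "\<dots> = max_potential p (2 * p') (norm x) y * w' + (4 * p' + 1) * (\<delta> * m)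
      - 2 * p' * (w * r) + 2 * p' * C * (norm d * \<bar>w' - w\<bar>)"
    by (simp add: algebra_simps)
  also have "\<delta> * m = C * ((s' - s) * m)" by (simp add: \<delta>_def)
  finally show ?thesis by (simp add: r_def mult.assoc)
qed

primrec running_S :: "real \<Rightarrow> (nat \<Rightarrow> 'a \<Rightarrow> 'x::real_normed_vector) \<Rightarrow> nat \<Rightarrow> 'a \<Rightarrow> real" where
  "running_S p g 0 \<omega> = norm (g 0 \<omega>)"
| "running_S p g (Suc n) \<omega> = pnorm p (running_S p g n \<omega>) (norm (g (Suc n) \<omega> - g n \<omega>))"

lemma running_S_nonneg: "0 \<le> running_S p g n \<omega>"
  by (cases n) auto

lemma running_S_mono_Suc: "0 < p \<Longrightarrow> running_S p g n \<omega> \<le> running_S p g (Suc n) \<omega>"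
  by (simp add: le_pnorm(1) running_S_nonneg)

context bounded_weight
begin

text \<open>The potential at time \<open>N\<close>, multiplied by the weight, dominates \<open>f\<^sub>N\<^sup>* w\<close>. The contraction from \<open>f\<close> to \<open>f'\<close>
  decreases the potential, which is monotone in its first argument. The constant comes from \<open>4 p'\<close> for
  the smoothness error, \<open>1\<close> for the updates of the maximum and \<open>11 p'\<close> for the interaction with the
  weight, together at most \<open>16 p'\<close>.\<close>

lemma weighted_maximal_finite:
  fixes f f' g :: "nat \<Rightarrow> 'a \<Rightarrow> 'x::banach"
  assumes sm: "smooth_banach TYPE('x) p C" and p: "1 < p" "p \<le> 2" "1 / p + 1 / p' = 1"
    and adapted: "adapted F g" "adapted F f" "adapted F f'"
    and mart: "banach_martingale M F g"
    and f0: "AE \<omega> in M. f 0 \<omega> = 0"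
    and rec: "\<And>n. AE \<omega> in M. f (Suc n) \<omega> = f' n \<omega> + (g (Suc n) \<omega> - g n \<omega>)"
    and contr: "\<And>n. AE \<omega> in M. norm (f' n \<omega>) \<le> norm (f n \<omega>)"
  shows "integrable M (running_max (\<lambda>n \<omega>. norm (f n \<omega>)) N)"
    and "integrable M (\<lambda>\<omega>. running_S p g N \<omega> * running_max W N \<omega>)"
    and "(\<integral>\<omega>. running_max (\<lambda>n \<omega>. norm (f n \<omega>)) N \<omega> * w \<omega> \<partial>M)
         \<le> 16 * p' * C * (\<integral>\<omega>. running_S p g N \<omega> * running_max W N \<omega> \<partial>M)"
proof -
  have C: "0 < C" using sm by (simp add: smooth_banach_def)
  have p': "1 < p'" by (rule conjugate_exponent_gt_1[OF p(1,3)])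
  define K where "K = 2 * p'"
  have K: "0 \<le> K" using p' by (simp add: K_def)
  define S where "S = running_S p g"
  define fn where "fn = (\<lambda>n \<omega>. norm (f n \<omega>))"
  define xn where "xn = (\<lambda>n \<omega>. norm (f' n \<omega>))"
  define d where "d = (\<lambda>n \<omega>. norm (g (Suc n) \<omega> - g n \<omega>))"
  define y where "y = (\<lambda>n \<omega>. max (running_max fn n \<omega>) (C * S n \<omega>))"
  \<comment> \<open>the weight times the slope of the tangent that occurs in the convexity bound\<close>
  define \<rho> where "\<rho> = (\<lambda>n \<omega>. W n \<omega> * (xn n \<omega> / pnorm p (xn n \<omega>) (y n \<omega>)) powr (p - 1))"
  define G where "G = (\<lambda>n \<omega>. max_potential p K (fn n \<omega>) (y n \<omega>))"
  \<comment> \<open>the potential after the contraction, before the next increment is added\<close>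
  define a where "a = (\<lambda>n \<omega>. max_potential p K (xn n \<omega>) (y n \<omega>))"
  define T where "T = (\<lambda>n \<omega>. S n \<omega> * running_max W n \<omega>)"
  define X where "X = (\<lambda>n \<omega>. d n \<omega> * \<bar>W (Suc n) \<omega> - W n \<omega>\<bar>)"
  define Z where "Z = (\<lambda>n \<omega>. norm (f' n \<omega> - (g (Suc n) \<omega> - g n \<omega>)) - norm (f' n \<omega>))"
  have gF: "strongly_measurable (F n) (g n)" and fF: "strongly_measurable (F n) (f n)"
    and f'F: "strongly_measurable (F n) (f' n)" for n
    using adapted by (simp_all add: adapted_def)
  have gM: "strongly_measurable M (g n)" for n
    by (rule strongly_measurable_from_subalgebra[OF subalg gF])
  have fn_meas: "fn n \<in> borel_measurable (F n)" and xn_meas: "xn n \<in> borel_measurable (F n)" for n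
    unfolding fn_def xn_def by (rule strongly_measurable_norm[OF fF] strongly_measurable_norm[OF f'F])+
  have d_meas: "d n \<in> borel_measurable (F (Suc n))" for n
  proof -
    have "subalgebra (F (Suc n)) (F n)"
      using F_mono[of n "Suc n"] by (simp add: subalgebra_def space_F)
    then show ?thesis
      unfolding d_def
      by (intro strongly_measurable_norm strongly_measurable_diff gF strongly_measurable_from_subalgebra[OF _ gF])
  qed
  have S_Suc: "S (Suc n) \<omega> = pnorm p (S n \<omega>) (d n \<omega>)" for n \<omega>
    by (simp add: S_def d_def)
  have S_meas: "S n \<in> borel_measurable (F n)" for n
  proof (induction n)
    case 0
    have "S 0 = (\<lambda>\<omega>. norm (g 0 \<omega>))" by (simp add: S_def fun_eq_iff)
    then show ?case using strongly_measurable_norm[OF gF] by simp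
  next
    case (Suc n)
    have eq: "S (Suc n) = (\<lambda>\<omega>. pnorm p (S n \<omega>) (d n \<omega>))" by (rule ext) (rule S_Suc)
    have [measurable]: "S n \<in> borel_measurable (F (Suc n))" by (rule F_measurable_mono[OF Suc]) simp
    note [measurable] = d_meas[of n]
    show ?case unfolding eq pnorm_def by measurable
  qed
  have y_meas: "y n \<in> borel_measurable (F n)" for n
  proof -
    note [measurable] = S_meas[of n] running_max_meas[of fn n, OF fn_meas]
    show ?thesis unfolding y_def by measurable
  qed
  have a_meas: "a n \<in> borel_measurable (F n)" and \<rho>_meas: "\<rho> n \<in> borel_measurable (F n)"
    and G_meas: "G n \<in> borel_measurable (F n)" for n
  proof -
    note [measurable] = y_meas[of n] xn_meas[of n] W_meas[of n] fn_meas[of n]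
    show "a n \<in> borel_measurable (F n)" unfolding a_def max_potential_def pnorm_def by measurable
    show "\<rho> n \<in> borel_measurable (F n)" unfolding \<rho>_def pnorm_def by measurable
    show "G n \<in> borel_measurable (F n)" unfolding G_def max_potential_def pnorm_def by measurable
  qed
  have S_nonneg: "0 \<le> S n \<omega>" for n \<omega> by (simp add: S_def running_S_nonneg)
  have S_mono: "S n \<omega> \<le> S (Suc n) \<omega>" for n \<omega>
    unfolding S_def using p by (intro running_S_mono_Suc) simp
  have d_nonneg: "0 \<le> d n \<omega>" for n \<omega> by (simp add: d_def)
  have y_nonneg: "0 \<le> y n \<omega>" for n \<omega>
    unfolding y_def using C S_nonneg[of n \<omega>] by (simp add: le_max_iff_disj)
  have y_Suc: "y (Suc n) \<omega> = max (max (y n \<omega>) (fn (Suc n) \<omega>)) (C * S (Suc n) \<omega>)" for n \<omega>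
  proof -
    have "C * S n \<omega> \<le> C * S (Suc n) \<omega>"
      using C by (intro mult_left_mono S_mono) simp
    then show ?thesis unfolding y_def running_max.simps by (auto simp: max_def)
  qed
  have g_int: "integrable M (\<lambda>\<omega>. norm (g n \<omega>))" for n
  proof -
    have "space M \<in> sets (F n)" using sets.top[of "F n"] by (simp add: space_F)
    then obtain I where "has_strong_integral M (\<lambda>\<omega>. indicator (space M) \<omega> *\<^sub>R g n \<omega>) I"
      using mart unfolding banach_martingale_def by blast
    then have "integrable M (\<lambda>\<omega>. norm (indicator (space M) \<omega> *\<^sub>R g n \<omega>))"
      by (rule has_strong_integral_integrable_norm)
    then show ?thesis
      by (rule Bochner_Integration.integrable_cong[THEN iffD1, rotated -1]) auto
  qed
  have d_int: "integrable M (d n)" for n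
  proof (rule Bochner_Integration.integrable_bound)
    show "integrable M (\<lambda>\<omega>. norm (g (Suc n) \<omega>) + norm (g n \<omega>))"
      by (intro Bochner_Integration.integrable_add g_int)
    show "AE \<omega> in M. norm (d n \<omega>) \<le> norm (norm (g (Suc n) \<omega>) + norm (g n \<omega>))"
      by (intro AE_I2) (simp add: d_def norm_triangle_ineq4)
  qed (rule F_measurable_M[OF d_meas])
  have pnorm_le: "pnorm p u v \<le> u + v" if "0 \<le> u" "0 \<le> v" for u v
    using pnorm_Lipschitz[of p 0 v u] that p by simp
  have S_int: "integrable M (S n)" for n
  proof (induction n)
    case 0
    have "S 0 = (\<lambda>\<omega>. norm (g 0 \<omega>))" by (simp add: S_def fun_eq_iff)
    then show ?case using g_int by simp
  next
    case (Suc n)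
    show ?case
    proof (rule Bochner_Integration.integrable_bound)
      show "integrable M (\<lambda>\<omega>. S n \<omega> + d n \<omega>)"
        by (intro Bochner_Integration.integrable_add Suc d_int)
      show "AE \<omega> in M. norm (S (Suc n) \<omega>) \<le> norm (S n \<omega> + d n \<omega>)"
        using pnorm_le[OF S_nonneg d_nonneg] by (intro AE_I2) (simp add: S_Suc S_nonneg d_nonneg)
    qed (rule F_measurable_M[OF S_meas])
  qed
  have f_int: "integrable M (fn n)" for n
  proof (induction n)
    case 0
    have "AE \<omega> in M. fn 0 \<omega> = 0" using f0 by eventually_elim (simp add: fn_def)
    then show ?case
      using F_measurable_M[OF fn_meas[of 0]] integrable_cong_AE[of "fn 0" M "\<lambda>_. 0"] by simp
  next
    case (Suc n)
    show ?case
    proof (rule Bochner_Integration.integrable_bound)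
      show "integrable M (\<lambda>\<omega>. fn n \<omega> + d n \<omega>)"
        by (intro Bochner_Integration.integrable_add Suc d_int)
      show "AE \<omega> in M. norm (fn (Suc n) \<omega>) \<le> norm (fn n \<omega> + d n \<omega>)"
        using rec[of n] contr[of n]
      proof eventually_elim
        case (elim \<omega>)
        have "norm (f (Suc n) \<omega>) \<le> norm (f' n \<omega>) + d n \<omega>"
          unfolding elim(1) d_def by (rule norm_triangle_ineq)
        then show ?case using elim(2) by (simp add: fn_def d_nonneg)
      qed
    qed (rule F_measurable_M[OF fn_meas])
  qed
  have x_int: "integrable M (xn n)" for n
  proof (rule Bochner_Integration.integrable_bound[OF f_int])
    show "AE \<omega> in M. norm (xn n \<omega>) \<le> norm (fn n \<omega>)"
      using contr[of n] by eventually_elim (simp add: xn_def fn_def)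
  qed (rule F_measurable_M[OF xn_meas])
  have running_max_fn_int: "integrable M (running_max fn n)" for n
  proof (induction n)
    case 0
    have "running_max fn 0 = fn 0" by (rule ext) simp
    then show ?case using f_int by simp
  next
    case (Suc n)
    have "running_max fn (Suc n) = (\<lambda>\<omega>. max (running_max fn n \<omega>) (fn (Suc n) \<omega>))" by (rule ext) simp
    then show ?case using Suc f_int[of "Suc n"] by simp
  qed
  have y_int: "integrable M (y n)" for n
    unfolding y_def using running_max_fn_int[of n] S_int[of n] by simp
  have max_potential_int: "integrable M (\<lambda>\<omega>. max_potential p K (u \<omega>) (y n \<omega>))"
    if u: "integrable M u" "\<And>\<omega>. 0 \<le> u \<omega>" "(\<lambda>\<omega>. max_potential p K (u \<omega>) (y n \<omega>)) \<in> borel_measurable M" for u n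
  proof (rule Bochner_Integration.integrable_bound)
    show "integrable M (\<lambda>\<omega>. K * u \<omega> + y n \<omega>)" using u y_int[of n] by simp
    show "AE \<omega> in M. norm (max_potential p K (u \<omega>) (y n \<omega>)) \<le> norm (K * u \<omega> + y n \<omega>)"
    proof (rule AE_I2)
      fix \<omega>
      have "0 \<le> max_potential p K (u \<omega>) (y n \<omega>)"
        using max_potential_ge[OF p(1) y_nonneg K] y_nonneg by (rule order_trans[rotated])
      then show "norm (max_potential p K (u \<omega>) (y n \<omega>)) \<le> norm (K * u \<omega> + y n \<omega>)"
        using max_potential_le[OF p(1) u(2)[of \<omega>] y_nonneg[of n \<omega>] K] by simp
    qed
  qed (rule u(3))
  have G_int: "integrable M (G n)" for n
    unfolding G_def
    by (rule max_potential_int[OF f_int]) (use F_measurable_M[OF G_meas[of n]] in \<open>auto simp: fn_def G_def\<close>)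
  have a_int: "integrable M (a n)" for n
    unfolding a_def
    by (rule max_potential_int[OF x_int]) (use F_measurable_M[OF a_meas[of n]] in \<open>auto simp: xn_def a_def\<close>)
  have T_int: "integrable M (T n)" for n
    unfolding T_def by (rule integrable_mult_running_maxW[OF S_int])
  have X_int: "integrable M (X n)" for n
    unfolding X_def
  proof (rule integrable_mult_bounded[where c = k, OF d_int])
    show "\<bar>\<bar>W (Suc n) \<omega> - W n \<omega>\<bar>\<bar> \<le> k" for \<omega>
      using W_nonneg[of n \<omega>] W_nonneg[of "Suc n" \<omega>] W_le[of n \<omega>] W_le[of "Suc n" \<omega>] by linarith
  qed measurable
  have \<rho>Z: "integrable M (\<lambda>\<omega>. \<rho> n \<omega> * Z n \<omega>)" "0 \<le> (\<integral>\<omega>. \<rho> n \<omega> * Z n \<omega> \<partial>M)" for n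
  proof -
    interpret sub: finite_measure_subalgebra M "F n"
      by unfold_locales (rule subalg)
    have mart': "\<exists>I. has_strong_integral M (\<lambda>\<omega>. indicator A \<omega> *\<^sub>R g n \<omega>) I
        \<and> has_strong_integral M (\<lambda>\<omega>. indicator A \<omega> *\<^sub>R g (Suc n) \<omega>) I" if "A \<in> sets (F n)" for A
      using mart that le_SucI[OF order_refl, of n] unfolding banach_martingale_def by blast
    have \<rho>_nonneg: "0 \<le> \<rho> n \<omega>" for \<omega> unfolding \<rho>_def using W_nonneg[of n \<omega>] by simp
    have \<rho>_le: "\<rho> n \<omega> \<le> k" for \<omega>
    proof -
      have "(xn n \<omega> / pnorm p (xn n \<omega>) (y n \<omega>)) powr (p - 1) \<le> 1"
        using p y_nonneg by (intro pnorm_slope_le_1) (auto simp: xn_def)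
      then have "\<rho> n \<omega> \<le> W n \<omega> * 1" unfolding \<rho>_def using W_nonneg[of n \<omega>] by (intro mult_left_mono)
      then show ?thesis using W_le[of n \<omega>] by simp
    qed
    note shift = sub.integral_norm_shift_nonneg[OF mart' gM gM f'F \<rho>_meas \<rho>_nonneg \<rho>_le]
    show "integrable M (\<lambda>\<omega>. \<rho> n \<omega> * Z n \<omega>)" unfolding Z_def by (rule shift(1))
    show "0 \<le> (\<integral>\<omega>. \<rho> n \<omega> * Z n \<omega> \<partial>M)" unfolding Z_def by (rule shift(2))
  qed
  have step: "(\<integral>\<omega>. G (Suc n) \<omega> * W (Suc n) \<omega> \<partial>M) \<le> (\<integral>\<omega>. G n \<omega> * W n \<omega> \<partial>M)
      + (4 * p' + 1) * C * ((\<integral>\<omega>. T (Suc n) \<omega> \<partial>M) - (\<integral>\<omega>. T n \<omega> \<partial>M)) + 2 * p' * C * (\<integral>\<omega>. X n \<omega> \<partial>M)" for n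
  proof -
    have "AE \<omega> in M. G (Suc n) \<omega> * W (Suc n) \<omega> \<le> a n \<omega> * W (Suc n) \<omega>
        + (4 * p' + 1) * C * (T (Suc n) \<omega> - T n \<omega>) - 2 * p' * (\<rho> n \<omega> * Z n \<omega>) + 2 * p' * C * X n \<omega>"
      using rec[of n]
    proof eventually_elim
      case (elim \<omega>)
      let ?m = "running_max W (Suc n) \<omega>"
      have "G (Suc n) \<omega> * W (Suc n) \<omega> \<le> a n \<omega> * W (Suc n) \<omega>
        + (4 * p' + 1) * C * ((S (Suc n) \<omega> - S n \<omega>) * ?m) - 2 * p' * (\<rho> n \<omega> * Z n \<omega>) + 2 * p' * C * X n \<omega>"
        unfolding G_def y_Suc fn_def elim a_def xn_def \<rho>_def Z_def X_def d_def S_Suc K_def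
      proof (rule max_potential_step[OF sm p(1,3)])
        show "W n \<omega> \<le> ?m" using running_max_ge[of W n \<omega>] running_max_mono[of n "Suc n" W \<omega>] by simp
        show "W (Suc n) \<omega> \<le> ?m" by (rule running_max_ge)
      qed (use p' S_nonneg W_nonneg in \<open>auto simp: y_def\<close>)
      moreover have "(S (Suc n) \<omega> - S n \<omega>) * ?m \<le> T (Suc n) \<omega> - T n \<omega>"
        using mult_left_mono[OF running_max_mono[of n "Suc n" W \<omega>] S_nonneg[of n \<omega>]]
        by (simp add: T_def left_diff_distrib del: running_max.simps)
      then have "(4 * p' + 1) * C * ((S (Suc n) \<omega> - S n \<omega>) * ?m) \<le> (4 * p' + 1) * C * (T (Suc n) \<omega> - T n \<omega>)"
        using p' C by (intro mult_left_mono) auto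
      ultimately show ?case by linarith
    qed
    then have "(\<integral>\<omega>. G (Suc n) \<omega> * W (Suc n) \<omega> \<partial>M) \<le> (\<integral>\<omega>. a n \<omega> * W (Suc n) \<omega>
        + (4 * p' + 1) * C * (T (Suc n) \<omega> - T n \<omega>) - 2 * p' * (\<rho> n \<omega> * Z n \<omega>) + 2 * p' * C * X n \<omega> \<partial>M)"
      by (intro integral_mono_AE Bochner_Integration.integrable_add Bochner_Integration.integrable_diff
          integrable_mult_W G_int a_int integrable_mult_right T_int X_int \<rho>Z)
    also have "\<dots> = (\<integral>\<omega>. a n \<omega> * W (Suc n) \<omega> \<partial>M)
        + (4 * p' + 1) * C * ((\<integral>\<omega>. T (Suc n) \<omega> \<partial>M) - (\<integral>\<omega>. T n \<omega> \<partial>M))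
        - 2 * p' * (\<integral>\<omega>. \<rho> n \<omega> * Z n \<omega> \<partial>M) + 2 * p' * C * (\<integral>\<omega>. X n \<omega> \<partial>M)"
      using integrable_mult_W[OF a_int[of n], of "Suc n"] T_int[of "Suc n"] T_int[of n] X_int[of n] \<rho>Z(1)[of n]
      by (simp add: Bochner_Integration.integral_add Bochner_Integration.integral_diff)
    finally have 1: "(\<integral>\<omega>. G (Suc n) \<omega> * W (Suc n) \<omega> \<partial>M) \<le> \<dots>" .
    have 2: "(\<integral>\<omega>. a n \<omega> * W (Suc n) \<omega> \<partial>M) = (\<integral>\<omega>. a n \<omega> * W n \<omega> \<partial>M)"
      by (rule W_martingale[OF a_meas a_int])
    have 3: "(\<integral>\<omega>. a n \<omega> * W n \<omega> \<partial>M) \<le> (\<integral>\<omega>. G n \<omega> * W n \<omega> \<partial>M)"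
    proof (intro integral_mono_AE integrable_mult_W a_int G_int)
      show "AE \<omega> in M. a n \<omega> * W n \<omega> \<le> G n \<omega> * W n \<omega>"
        using contr[of n]
      proof eventually_elim
        case (elim \<omega>)
        have "a n \<omega> \<le> G n \<omega>"
          unfolding a_def G_def using elim p K y_nonneg by (intro max_potential_mono) (auto simp: xn_def fn_def)
        then show ?case by (intro mult_right_mono W_nonneg)
      qed
    qed
    have 4: "0 \<le> 2 * p' * (\<integral>\<omega>. \<rho> n \<omega> * Z n \<omega> \<partial>M)"
      using p' \<rho>Z(2)[of n] by simp
    show ?thesis using 1 2 3 4 by linarith
  qed
  have init: "(\<integral>\<omega>. G 0 \<omega> * W 0 \<omega> \<partial>M) = C * (\<integral>\<omega>. T 0 \<omega> \<partial>M)"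
  proof -
    have "(\<integral>\<omega>. G 0 \<omega> * W 0 \<omega> \<partial>M) = (\<integral>\<omega>. C * T 0 \<omega> \<partial>M)"
    proof (rule integral_cong_AE)
      show "AE \<omega> in M. G 0 \<omega> * W 0 \<omega> = C * T 0 \<omega>"
        using f0
      proof eventually_elim
        case (elim \<omega>)
        have "0 \<le> C * S 0 \<omega>" using C S_nonneg[of 0 \<omega>] by simp
        then have "y 0 \<omega> = C * S 0 \<omega>" using elim by (simp add: y_def fn_def)
        then have "G 0 \<omega> = C * S 0 \<omega>"
          using elim p \<open>0 \<le> C * S 0 \<omega>\<close> by (simp add: G_def fn_def max_potential_def algebra_simps)
        then show ?case by (simp add: T_def)
      qed
    qed (use borel_measurable_integrable[OF integrable_mult_W[OF G_int]] borel_measurable_integrable[OF T_int] in auto)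
    then show ?thesis by simp
  qed
  have sum: "(\<integral>\<omega>. G n \<omega> * W n \<omega> \<partial>M) \<le> (4 * p' + 1) * C * (\<integral>\<omega>. T n \<omega> \<partial>M)
      + 2 * p' * C * (\<Sum>i<n. \<integral>\<omega>. X i \<omega> \<partial>M)" for n
  proof (induction n)
    case 0
    have "0 \<le> (\<integral>\<omega>. T 0 \<omega> \<partial>M)"
      by (intro integral_nonneg_AE AE_I2) (simp add: T_def S_nonneg W_nonneg)
    then have "C * (\<integral>\<omega>. T 0 \<omega> \<partial>M) \<le> (4 * p' + 1) * C * (\<integral>\<omega>. T 0 \<omega> \<partial>M)"
      using C p' by (intro mult_right_mono) auto
    then show ?case by (simp add: init)
  next
    case (Suc n)
    then show ?case using step[of n] by (simp add: algebra_simps)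
  qed
  have cross: "(\<Sum>i<N. \<integral>\<omega>. X i \<omega> \<partial>M) \<le> 11 / 2 * (\<integral>\<omega>. T N \<omega> \<partial>M)"
  proof -
    have "(\<Sum>i<N. \<integral>\<omega>. X i \<omega> \<partial>M) = (\<integral>\<omega>. (\<Sum>i<N. X i \<omega>) \<partial>M)"
      by (rule Bochner_Integration.integral_sum[OF X_int, symmetric])
    also have "\<dots> \<le> 11 / 2 * (\<integral>\<omega>. T N \<omega> \<partial>M)"
      unfolding X_def T_def
    proof (rule cross_variation_le[OF S_meas S_int d_int S_nonneg S_mono d_nonneg])
      show "(d n \<omega>)\<^sup>2 \<le> 2 * S (Suc n) \<omega> * (S (Suc n) \<omega> - S n \<omega>)" for n \<omega>
        unfolding S_Suc by (rule pnorm_square_increment[OF p(1,2) S_nonneg d_nonneg])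
    qed
    finally show ?thesis .
  qed
  have TN: "0 \<le> (\<integral>\<omega>. T N \<omega> \<partial>M)"
    by (intro integral_nonneg_AE AE_I2) (simp add: T_def S_nonneg running_maxW_nonneg)
  show "integrable M (running_max (\<lambda>n \<omega>. norm (f n \<omega>)) N)"
    using running_max_fn_int by (simp add: fn_def)
  show "integrable M (\<lambda>\<omega>. running_S p g N \<omega> * running_max W N \<omega>)"
    using T_int[of N] by (simp add: T_def S_def)
  have "(\<integral>\<omega>. running_max fn N \<omega> * w \<omega> \<partial>M) = (\<integral>\<omega>. running_max fn N \<omega> * W N \<omega> \<partial>M)"
    by (rule W_cond[OF running_max_meas[OF fn_meas] running_max_fn_int, symmetric])
  also have "\<dots> \<le> (\<integral>\<omega>. G N \<omega> * W N \<omega> \<partial>M)"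
  proof (intro integral_mono integrable_mult_W G_int running_max_fn_int mult_right_mono W_nonneg)
    fix \<omega>
    show "running_max fn N \<omega> \<le> G N \<omega>"
      unfolding G_def by (rule order_trans[OF _ max_potential_ge[OF p(1) y_nonneg K]]) (simp add: y_def)
  qed
  also have "\<dots> \<le> (4 * p' + 1) * C * (\<integral>\<omega>. T N \<omega> \<partial>M) + 2 * p' * C * (11 / 2 * (\<integral>\<omega>. T N \<omega> \<partial>M))"
    using p' C by (intro order_trans[OF sum] add_left_mono mult_left_mono cross) auto
  also have "\<dots> = (15 * p' + 1) * (C * (\<integral>\<omega>. T N \<omega> \<partial>M))" by (simp add: algebra_simps)
  also have "\<dots> \<le> (16 * p') * (C * (\<integral>\<omega>. T N \<omega> \<partial>M))"
    using p' C TN by (intro mult_right_mono) auto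
  finally show "(\<integral>\<omega>. running_max (\<lambda>n \<omega>. norm (f n \<omega>)) N \<omega> * w \<omega> \<partial>M)
         \<le> 16 * p' * C * (\<integral>\<omega>. running_S p g N \<omega> * running_max W N \<omega> \<partial>M)"
    by (simp add: fn_def T_def S_def mult.assoc)
qed

end

section \<open>General weights and Lebesgue norms\<close>

lemma enn_power_ennreal: "0 \<le> x \<Longrightarrow> enn_power (ennreal x) a = ennreal (x powr a)"
  by (simp add: enn_power_def)

lemma enn_power_top [simp]: "enn_power top a = top" "enn_power \<infinity> a = top"
  by (simp_all add: enn_power_def)

lemma enn_power_mono:
  assumes "0 \<le> a" "x \<le> y"
  shows "enn_power x a \<le> enn_power y a"
proof (cases y)
  case (real v)
  then obtain u where u: "x = ennreal u" "0 \<le> u"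
    using assms(2) by (cases x) (auto simp: top_unique)
  then show ?thesis
    using real assms by (simp add: enn_power_ennreal powr_mono2 ennreal_leI)
qed simp

lemma enn_power_inverse:
  assumes "0 < a"
  shows "enn_power (enn_power x a) (1 / a) = x" "enn_power (enn_power x (1 / a)) a = x"
  using assms by (cases x; simp add: enn_power_ennreal powr_powr)+

lemma enn_power_1 [simp]: "enn_power x 1 = x"
  by (cases x) (simp_all add: enn_power_ennreal)

lemma enn_power_measurable [measurable (raw)]:
  assumes [measurable]: "h \<in> borel_measurable M"
  shows "(\<lambda>\<omega>. enn_power (h \<omega>) a) \<in> borel_measurable M"
  unfolding enn_power_def by measurable

text \<open>Powers are order isomorphisms of \<open>[0, \<infinity>]\<close>, hence commute with suprema.\<close>

lemma enn_power_SUP: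
  fixes a :: "nat \<Rightarrow> ennreal"
  assumes "0 < c"
  shows "enn_power (SUP n. a n) c = (SUP n. enn_power (a n) c)"
proof (rule antisym)
  have "a n \<le> enn_power (SUP n. enn_power (a n) c) (1 / c)" for n
  proof -
    have "enn_power (enn_power (a n) c) (1 / c) \<le> enn_power (SUP n. enn_power (a n) c) (1 / c)"
      using assms by (intro enn_power_mono SUP_upper) auto
    then show ?thesis by (simp add: enn_power_inverse assms)
  qed
  then have "enn_power (SUP n. a n) c \<le> enn_power (enn_power (SUP n. enn_power (a n) c) (1 / c)) c"
    using assms by (intro enn_power_mono SUP_least) auto
  then show "enn_power (SUP n. a n) c \<le> (SUP n. enn_power (a n) c)"
    by (simp add: enn_power_inverse assms)
  show "(SUP n. enn_power (a n) c) \<le> enn_power (SUP n. a n) c"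
    using assms by (intro SUP_least enn_power_mono SUP_upper) auto
qed

lemma ennreal_Young:
  assumes r: "1 < r" "1 < q" "1 / r + 1 / q = 1" and pos: "0 < \<sigma>" "0 < \<beta>"
  shows "a * b \<le> ennreal (\<sigma> * \<beta> / (r * \<sigma> powr r)) * enn_power a r
    + ennreal (\<sigma> * \<beta> / (q * \<beta> powr q)) * enn_power b q"
proof -
  have c: "0 < \<sigma> * \<beta> / (r * \<sigma> powr r)" "0 < \<sigma> * \<beta> / (q * \<beta> powr q)"
    using r pos by auto
  show ?thesis
  proof (cases "a = top \<or> b = top")
    case True
    then show ?thesis using c by (auto simp: ennreal_mult_top)
  next
    case False
    then obtain x y where x: "a = ennreal x" "0 \<le> x" and y: "b = ennreal y" "0 \<le> y"
      by (cases a; cases b) auto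
    have "x * y = \<sigma> * \<beta> * ((x / \<sigma>) * (y / \<beta>))" using pos by simp
    also have "\<dots> \<le> \<sigma> * \<beta> * ((x / \<sigma>) powr r / r + (y / \<beta>) powr q / q)"
      using pos x y r by (intro mult_left_mono Youngs_inequality) auto
    also have "\<dots> = \<sigma> * \<beta> / (r * \<sigma> powr r) * x powr r + \<sigma> * \<beta> / (q * \<beta> powr q) * y powr q"
      using pos x y by (simp add: powr_divide distrib_left mult_ac)
    finally have "x * y \<le> \<dots>" .
    then have "ennreal (x * y) \<le> ennreal (\<sigma> * \<beta> / (r * \<sigma> powr r) * x powr r + \<sigma> * \<beta> / (q * \<beta> powr q) * y powr q)"
      by (rule ennreal_leI)
    also have "\<dots> = ennreal (\<sigma> * \<beta> / (r * \<sigma> powr r)) * ennreal (x powr r)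
        + ennreal (\<sigma> * \<beta> / (q * \<beta> powr q)) * ennreal (y powr q)"
      using less_imp_le[OF c(1)] less_imp_le[OF c(2)]
      by (subst ennreal_plus) (simp_all only: ennreal_mult mult_nonneg_nonneg powr_ge_zero)
    finally show ?thesis
      using x y by (simp add: enn_power_ennreal ennreal_mult)
  qed
qed

text \<open>Hoelder's inequality in terms of upper bounds for the two norms, which avoids any case distinction
  on norms that vanish or are infinite.\<close>

lemma nn_integral_Hoelder:
  assumes r: "1 < r" "1 < q" "1 / r + 1 / q = 1" and pos: "0 < \<sigma>" "0 < \<beta>"
    and [measurable]: "S \<in> borel_measurable M" "T \<in> borel_measurable M"
    and S: "(\<integral>\<^sup>+\<omega>. enn_power (S \<omega>) r \<partial>M) \<le> ennreal (\<sigma> powr r)"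
    and T: "(\<integral>\<^sup>+\<omega>. enn_power (T \<omega>) q \<partial>M) \<le> ennreal (\<beta> powr q)"
  shows "(\<integral>\<^sup>+\<omega>. S \<omega> * T \<omega> \<partial>M) \<le> ennreal (\<sigma> * \<beta>)"
proof -
  define c where "c = \<sigma> * \<beta> / (r * \<sigma> powr r)"
  define e where "e = \<sigma> * \<beta> / (q * \<beta> powr q)"
  have ce: "0 \<le> c" "0 \<le> e" using r pos by (simp_all add: c_def e_def)
  have "(\<integral>\<^sup>+\<omega>. S \<omega> * T \<omega> \<partial>M) \<le> (\<integral>\<^sup>+\<omega>. ennreal c * enn_power (S \<omega>) r + ennreal e * enn_power (T \<omega>) q \<partial>M)"
    unfolding c_def e_def by (intro nn_integral_mono ennreal_Young r pos)
  also have "\<dots> = ennreal c * (\<integral>\<^sup>+\<omega>. enn_power (S \<omega>) r \<partial>M) + ennreal e * (\<integral>\<^sup>+\<omega>. enn_power (T \<omega>) q \<partial>M)"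
    by (simp add: nn_integral_add nn_integral_cmult)
  also have "\<dots> \<le> ennreal c * ennreal (\<sigma> powr r) + ennreal e * ennreal (\<beta> powr q)"
    by (intro add_mono mult_left_mono S T) auto
  also have "\<dots> = ennreal (c * \<sigma> powr r + e * \<beta> powr q)"
    using ce by (simp add: ennreal_mult ennreal_plus)
  also have "c * \<sigma> powr r + e * \<beta> powr q = \<sigma> * \<beta> * (1 / r + 1 / q)"
    using pos unfolding distrib_left by (simp add: c_def e_def)
  finally show ?thesis by (simp add: r(3))
qed

lemma running_S_le_S_fun:
  assumes "0 < p"
  shows "ennreal (running_S p g N \<omega>) \<le> S_fun p g \<omega>"
proof -
  have eq: "running_S p g N \<omega> powr p = norm (g 0 \<omega>) powr p + (\<Sum>n<N. norm (g (Suc n) \<omega> - g n \<omega>) powr p)" for N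
    by (induction N) (simp_all add: pnorm_powr assms)
  have "enn_power (ennreal (running_S p g N \<omega>)) p = ennreal (norm (g 0 \<omega>) powr p)
      + (\<Sum>n<N. ennreal (norm (g (Suc n) \<omega> - g n \<omega>) powr p))"
    by (simp add: enn_power_ennreal running_S_nonneg eq ennreal_plus sum_nonneg)
  also have "\<dots> \<le> ennreal (norm (g 0 \<omega>) powr p) + (\<Sum>n. ennreal (norm (g (Suc n) \<omega> - g n \<omega>) powr p))"
    by (intro add_left_mono sum_le_suminf) auto
  finally have "enn_power (enn_power (ennreal (running_S p g N \<omega>)) p) (1 / p) \<le> S_fun p g \<omega>"
    unfolding S_fun_def using assms by (intro enn_power_mono) auto
  then show ?thesis by (simp add: enn_power_inverse assms)
qed

lemma SUP_running_max:
  assumes "\<And>n. 0 \<le> h n \<omega>"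
  shows "(SUP n. ennreal (running_max h n \<omega>)) = (SUP n. ennreal (h n \<omega>))"
proof (rule antisym)
  have "ennreal (running_max h n \<omega>) \<le> (SUP n. ennreal (h n \<omega>))" for n
  proof (induction n)
    case (Suc n)
    then show ?case
      using SUP_upper[of "Suc n" UNIV "\<lambda>n. ennreal (h n \<omega>)"] by (simp add: max_def)
  qed (auto intro: SUP_upper)
  then show "(SUP n. ennreal (running_max h n \<omega>)) \<le> (SUP n. ennreal (h n \<omega>))"
    by (rule SUP_least)
  show "(SUP n. ennreal (h n \<omega>)) \<le> (SUP n. ennreal (running_max h n \<omega>))"
    by (intro SUP_mono) (auto intro!: exI ennreal_leI running_max_ge)
qed

lemma ennreal_SUP_min:
  fixes x :: ennreal
  shows "(SUP k::nat. min x (of_nat k)) = x"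
proof -
  have "(SUP k::nat. inf x (of_nat k :: ennreal)) = inf x (SUP k::nat. of_nat k)"
    by (rule inf_SUP[symmetric])
  then show ?thesis
    by (simp add: inf_min ennreal_SUP_of_nat_eq_top)
qed

text \<open>The real conditional expectation is cut off at \<open>0\<close> and \<open>k\<close>, which changes it on a null set only. It
  agrees with the \<open>[0, \<infinity>]\<close>-valued one as both have the same integrals over the sets of \<open>F n\<close>.\<close>

lemma (in prob_space) bounded_weight_cond_exp:
  assumes subalg: "\<And>n. subalgebra M (F n)" and F_mono: "\<And>m n. m \<le> n \<Longrightarrow> sets (F m) \<subseteq> sets (F n)"
    and w[measurable]: "w \<in> borel_measurable M"
    and w_nonneg: "\<And>\<omega>. \<omega> \<in> space M \<Longrightarrow> 0 \<le> w \<omega>" and w_le: "\<And>\<omega>. \<omega> \<in> space M \<Longrightarrow> w \<omega> \<le> k"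
  obtains W where "bounded_weight M F w W k"
    "\<And>n. AE \<omega> in M. ennreal (W n \<omega>) = nn_cond_exp M (F n) (\<lambda>\<omega>. ennreal (w \<omega>)) \<omega>"
proof -
  define W where "W = (\<lambda>n \<omega>. max 0 (min k (real_cond_exp M (F n) w \<omega>)))"
  obtain \<omega>0 where "\<omega>0 \<in> space M" using not_empty by blast
  then have k: "0 \<le> k" using w_nonneg w_le order_trans by blast
  have W_bounds: "0 \<le> W n \<omega>" "W n \<omega> \<le> k" for n \<omega>
    using k by (simp_all add: W_def)
  have W_meas: "W n \<in> borel_measurable (F n)" for n
    unfolding W_def by measurable
  have WM[measurable]: "W n \<in> borel_measurable M" for n
    by (rule measurable_from_subalg[OF subalg W_meas])
  have w_int: "integrable M w"
    by (rule integrable_const_bound[of _ k]) (auto simp: w_nonneg w_le)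
  have bound: "integrable M (\<lambda>\<omega>. Z \<omega> * w \<omega>)" if "integrable M Z" for Z
  proof (rule Bochner_Integration.integrable_bound)
    show "integrable M (\<lambda>\<omega>. Z \<omega> * k)" using that by simp
    show "(\<lambda>\<omega>. Z \<omega> * w \<omega>) \<in> borel_measurable M"
      using borel_measurable_integrable[OF that] by measurable
    show "AE \<omega> in M. norm (Z \<omega> * w \<omega>) \<le> norm (Z \<omega> * k)"
      using w_nonneg w_le k by (intro AE_I2) (simp add: abs_mult mult_left_mono)
  qed
  have AE_eq: "AE \<omega> in M. W n \<omega> = real_cond_exp M (F n) w \<omega>" for n
  proof -
    interpret sub: finite_measure_subalgebra M "F n" by unfold_locales (rule subalg)
    have "AE \<omega> in M. 0 \<le> real_cond_exp M (F n) w \<omega>"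
      by (rule sub.real_cond_exp_pos) (auto simp: w_nonneg)
    moreover have "AE \<omega> in M. real_cond_exp M (F n) w \<omega> \<le> k"
      by (rule sub.real_cond_exp_le_c[OF w_int]) (auto simp: w_le)
    ultimately show ?thesis by eventually_elim (simp add: W_def)
  qed
  have cond: "(\<integral>\<omega>. Z \<omega> * W n \<omega> \<partial>M) = (\<integral>\<omega>. Z \<omega> * w \<omega> \<partial>M)"
    if Z: "Z \<in> borel_measurable (F n)" "integrable M Z" for Z n
  proof -
    interpret sub: finite_measure_subalgebra M "F n" by unfold_locales (rule subalg)
    note [measurable] = borel_measurable_integrable[OF Z(2)]
    have "(\<integral>\<omega>. Z \<omega> * W n \<omega> \<partial>M) = (\<integral>\<omega>. Z \<omega> * real_cond_exp M (F n) w \<omega> \<partial>M)"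
    proof (rule integral_cong_AE)
      show "AE \<omega> in M. Z \<omega> * W n \<omega> = Z \<omega> * real_cond_exp M (F n) w \<omega>"
        using AE_eq[of n] by eventually_elim simp
    qed measurable
    also have "\<dots> = (\<integral>\<omega>. Z \<omega> * w \<omega> \<partial>M)"
      by (rule sub.real_cond_exp_intg(2)[OF bound[OF Z(2)] Z(1) w])
    finally show ?thesis .
  qed
  have bw: "bounded_weight M F w W k"
    by unfold_locales (auto simp: subalg W_meas W_bounds w_nonneg w_le cond dest: F_mono[THEN subsetD])
  moreover have "AE \<omega> in M. ennreal (W n \<omega>) = nn_cond_exp M (F n) (\<lambda>\<omega>. ennreal (w \<omega>)) \<omega>" for n
  proof -
    interpret sub: finite_measure_subalgebra M "F n" by unfold_locales (rule subalg)
    interpret bw: bounded_weight M F w W k by (rule bw)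
    show ?thesis
    proof (rule sub.nn_cond_exp_charact)
      fix A assume A: "A \<in> sets (F n)"
      then have AM: "A \<in> sets M" using subalg[of n] by (auto simp: subalgebra_def)
      have ind: "integrable M (indicator A :: _ \<Rightarrow> real)"
        using AM by (intro integrable_real_indicator) (simp_all add: less_top[symmetric])
      have ind_eq: "(\<integral>\<^sup>+\<omega>\<in>A. ennreal (u \<omega>) \<partial>M) = ennreal (\<integral>\<omega>. indicator A \<omega> * u \<omega> \<partial>M)"
        if "integrable M (\<lambda>\<omega>. indicator A \<omega> * u \<omega>)" "\<And>\<omega>. \<omega> \<in> space M \<Longrightarrow> 0 \<le> u \<omega>" for u :: "'a \<Rightarrow> real"
      proof -
        have "(\<integral>\<^sup>+\<omega>\<in>A. ennreal (u \<omega>) \<partial>M) = (\<integral>\<^sup>+\<omega>. ennreal (indicator A \<omega> * u \<omega>) \<partial>M)"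
          by (intro nn_integral_cong) (auto simp: indicator_def)
        also have "\<dots> = ennreal (\<integral>\<omega>. indicator A \<omega> * u \<omega> \<partial>M)"
          using that by (intro nn_integral_eq_integral) (auto intro!: AE_I2)
        finally show ?thesis .
      qed
      have "(\<integral>\<omega>. indicator A \<omega> * W n \<omega> \<partial>M) = (\<integral>\<omega>. indicator A \<omega> * w \<omega> \<partial>M)"
        using A by (intro cond ind) simp
      then show "(\<integral>\<^sup>+\<omega>\<in>A. ennreal (w \<omega>) \<partial>M) = (\<integral>\<^sup>+\<omega>\<in>A. ennreal (W n \<omega>) \<partial>M)"
        using ind_eq[OF bw.integrable_mult_w[OF ind] w_nonneg] ind_eq[OF bw.integrable_mult_W[OF ind] W_bounds(1)]
        by simp
    qed (use W_meas in measurable)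
  qed
  ultimately show ?thesis by (rule that)
qed

text \<open>The setting of the theorem with the time index shifted to avoid subtraction; the condition \<open>f' 0 = 0\<close>
  takes the form of the case \<open>n = 0\<close> of the contraction property.\<close>

locale contractive_recursion = prob_space M for M :: "'a measure" +
  fixes F :: "nat \<Rightarrow> 'a measure" and g f f' :: "nat \<Rightarrow> 'a \<Rightarrow> 'x::banach" and p p' C :: real
  assumes subalg: "\<And>n. subalgebra M (F n)"
    and F_mono: "\<And>m n. m \<le> n \<Longrightarrow> sets (F m) \<subseteq> sets (F n)"
    and smooth: "smooth_banach TYPE('x) p C" and p: "1 < p" "p \<le> 2" "1 / p + 1 / p' = 1"
    and adapted: "adapted F g" "adapted F f" "adapted F f'"
    and martingale: "banach_martingale M F g"
    and initial: "AE \<omega> in M. f 0 \<omega> = 0"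
    and recursion: "\<And>n. AE \<omega> in M. f (Suc n) \<omega> = f' n \<omega> + (g (Suc n) \<omega> - g n \<omega>)"
    and contraction: "\<And>n. AE \<omega> in M. norm (f' n \<omega>) \<le> norm (f n \<omega>)"
begin

lemma C_pos: "0 < C"
  using smooth by (simp add: smooth_banach_def)

lemma p'_gt_1: "1 < p'"
  by (rule conjugate_exponent_gt_1[OF p(1,3)])

lemma strongly_measurable_processes: "strongly_measurable M (g n)" "strongly_measurable M (f n)"
  using adapted by (auto simp: adapted_def intro: strongly_measurable_from_subalgebra[OF subalg])

lemma max_fun_measurable [measurable]: "max_fun f \<in> borel_measurable M"
proof -
  have [measurable]: "(\<lambda>\<omega>. norm (f n \<omega>)) \<in> borel_measurable M" for n
    by (rule strongly_measurable_norm[OF strongly_measurable_processes(2)])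
  show ?thesis unfolding max_fun_def by measurable
qed

lemma S_fun_measurable [measurable]: "S_fun p g \<in> borel_measurable M"
proof -
  have [measurable]: "(\<lambda>\<omega>. norm (g 0 \<omega>)) \<in> borel_measurable M"
    by (rule strongly_measurable_norm[OF strongly_measurable_processes(1)])
  have [measurable]: "(\<lambda>\<omega>. norm (g (Suc n) \<omega> - g n \<omega>)) \<in> borel_measurable M" for n
    by (intro strongly_measurable_norm strongly_measurable_diff strongly_measurable_processes)
  show ?thesis unfolding S_fun_def by measurable
qed

lemma weight_max_measurable [measurable]: "weight_max M F w \<in> borel_measurable M"
  unfolding weight_max_def by measurable

lemma running_max_norm_measurable [measurable]: "running_max (\<lambda>n \<omega>. norm (f n \<omega>)) N \<in> borel_measurable M"
proof (induction N)
  case 0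
  have "running_max (\<lambda>n \<omega>. norm (f n \<omega>)) 0 = (\<lambda>\<omega>. norm (f 0 \<omega>))" by (rule ext) simp
  then show ?case using strongly_measurable_norm[OF strongly_measurable_processes(2)] by simp
next
  case (Suc N)
  have "running_max (\<lambda>n \<omega>. norm (f n \<omega>)) (Suc N) = (\<lambda>\<omega>. max (running_max (\<lambda>n \<omega>. norm (f n \<omega>)) N \<omega>) (norm (f (Suc N) \<omega>)))"
    by (rule ext) simp
  then show ?case using Suc strongly_measurable_norm[OF strongly_measurable_processes(2)] by simp
qed

lemma max_fun_eq_SUP_running_max: "max_fun f \<omega> = (SUP N. ennreal (running_max (\<lambda>n \<omega>. norm (f n \<omega>)) N \<omega>))"
  unfolding max_fun_def by (rule SUP_running_max[symmetric]) simp

lemma weight_max_mono: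
  assumes [measurable]: "v \<in> borel_measurable M" "w \<in> borel_measurable M"
    and le: "\<And>\<omega>. \<omega> \<in> space M \<Longrightarrow> v \<omega> \<le> w \<omega>"
  shows "AE \<omega> in M. weight_max M F v \<omega> \<le> weight_max M F w \<omega>"
proof -
  have "AE \<omega> in M. \<forall>n. nn_cond_exp M (F n) (\<lambda>\<omega>. ennreal (v \<omega>)) \<omega> \<le> nn_cond_exp M (F n) (\<lambda>\<omega>. ennreal (w \<omega>)) \<omega>"
    unfolding AE_all_countable
  proof
    fix n
    interpret sub: finite_measure_subalgebra M "F n" by unfold_locales (rule subalg)
    show "AE \<omega> in M. nn_cond_exp M (F n) (\<lambda>\<omega>. ennreal (v \<omega>)) \<omega> \<le> nn_cond_exp M (F n) (\<lambda>\<omega>. ennreal (w \<omega>)) \<omega>"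
      by (rule sub.nn_cond_exp_mono) (auto intro!: AE_I2 ennreal_leI le)
  qed
  then show ?thesis
    unfolding weight_max_def by eventually_elim (intro SUP_mono, blast)
qed

lemma weighted_maximal_bounded:
  assumes w[measurable]: "w \<in> borel_measurable M"
    and w_nonneg: "\<And>\<omega>. \<omega> \<in> space M \<Longrightarrow> 0 \<le> w \<omega>" and w_le: "\<And>\<omega>. \<omega> \<in> space M \<Longrightarrow> w \<omega> \<le> k"
  shows "(\<integral>\<^sup>+\<omega>. max_fun f \<omega> * ennreal (w \<omega>) \<partial>M)
    \<le> ennreal (16 * p' * C) * (\<integral>\<^sup>+\<omega>. S_fun p g \<omega> * weight_max M F w \<omega> \<partial>M)"
proof -
  obtain W where bw: "bounded_weight M F w W k"
    and W: "\<And>n. AE \<omega> in M. ennreal (W n \<omega>) = nn_cond_exp M (F n) (\<lambda>\<omega>. ennreal (w \<omega>)) \<omega>"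
    by (rule bounded_weight_cond_exp[OF subalg F_mono w w_nonneg w_le]) auto
  interpret bounded_weight M F w W k by (rule bw)
  define R where "R = (\<lambda>N. running_max (\<lambda>n \<omega>. norm (f n \<omega>)) N)"
  have R_meas[measurable]: "R N \<in> borel_measurable M" for N
    unfolding R_def by measurable
  have R_nonneg: "0 \<le> R N \<omega>" for N \<omega>
    unfolding R_def using running_max_ge[of "\<lambda>n \<omega>. norm (f n \<omega>)" N \<omega>] norm_ge_zero[of "f N \<omega>"] by linarith
  have AE_max: "AE \<omega> in M. weight_max M F w \<omega> = (SUP n. ennreal (running_max W n \<omega>))"
  proof -
    have "AE \<omega> in M. \<forall>n. ennreal (W n \<omega>) = nn_cond_exp M (F n) (\<lambda>\<omega>. ennreal (w \<omega>)) \<omega>"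
      unfolding AE_all_countable using W by blast
    then show ?thesis
      by eventually_elim (simp add: weight_max_def SUP_running_max W_nonneg)
  qed
  have finite: "(\<integral>\<^sup>+\<omega>. ennreal (R N \<omega>) * ennreal (w \<omega>) \<partial>M)
      \<le> ennreal (16 * p' * C) * (\<integral>\<^sup>+\<omega>. S_fun p g \<omega> * weight_max M F w \<omega> \<partial>M)" for N
  proof -
    note fin = weighted_maximal_finite[OF smooth p adapted martingale initial recursion contraction, of N]
    have c: "0 \<le> 16 * p' * C" using p'_gt_1 C_pos by simp
    have "(\<integral>\<^sup>+\<omega>. ennreal (R N \<omega>) * ennreal (w \<omega>) \<partial>M) = (\<integral>\<^sup>+\<omega>. ennreal (R N \<omega> * w \<omega>) \<partial>M)"
      by (intro nn_integral_cong) (simp add: ennreal_mult R_nonneg w_nonneg)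
    also have "\<dots> = ennreal (\<integral>\<omega>. R N \<omega> * w \<omega> \<partial>M)"
    proof (rule nn_integral_eq_integral)
      show "integrable M (\<lambda>\<omega>. R N \<omega> * w \<omega>)"
        unfolding R_def by (rule integrable_mult_w[OF fin(1)])
    qed (auto simp: R_nonneg w_nonneg)
    also have "\<dots> \<le> ennreal (16 * p' * C * (\<integral>\<omega>. running_S p g N \<omega> * running_max W N \<omega> \<partial>M))"
      unfolding R_def by (rule ennreal_leI[OF fin(3)])
    also have "\<dots> = ennreal (16 * p' * C) * ennreal (\<integral>\<omega>. running_S p g N \<omega> * running_max W N \<omega> \<partial>M)"
      using c by (intro ennreal_mult integral_nonneg_AE AE_I2) (simp_all add: running_S_nonneg running_maxW_nonneg)
    also have "ennreal (\<integral>\<omega>. running_S p g N \<omega> * running_max W N \<omega> \<partial>M) = (\<integral>\<^sup>+\<omega>. ennreal (running_S p g N \<omega> * running_max W N \<omega>) \<partial>M)"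
      by (rule nn_integral_eq_integral[symmetric, OF fin(2)]) (simp add: running_S_nonneg running_maxW_nonneg)
    also have "\<dots> \<le> (\<integral>\<^sup>+\<omega>. S_fun p g \<omega> * weight_max M F w \<omega> \<partial>M)"
    proof (rule nn_integral_mono_AE)
      show "AE \<omega> in M. ennreal (running_S p g N \<omega> * running_max W N \<omega>) \<le> S_fun p g \<omega> * weight_max M F w \<omega>"
        using AE_max
      proof eventually_elim
        case (elim \<omega>)
        have "ennreal (running_S p g N \<omega>) * ennreal (running_max W N \<omega>) \<le> S_fun p g \<omega> * weight_max M F w \<omega>"
          unfolding elim using p by (intro mult_mono running_S_le_S_fun SUP_upper) auto
        then show ?case by (simp add: ennreal_mult running_S_nonneg running_maxW_nonneg)
      qed
    qed
    finally show ?thesis by (simp add: mult_left_mono)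
  qed
  have "(\<integral>\<^sup>+\<omega>. max_fun f \<omega> * ennreal (w \<omega>) \<partial>M) = (\<integral>\<^sup>+\<omega>. (SUP N. ennreal (R N \<omega>) * ennreal (w \<omega>)) \<partial>M)"
    by (simp add: max_fun_eq_SUP_running_max R_def SUP_mult_right_ennreal)
  also have "\<dots> = (SUP N. \<integral>\<^sup>+\<omega>. ennreal (R N \<omega>) * ennreal (w \<omega>) \<partial>M)"
  proof (rule nn_integral_monotone_convergence_SUP)
    show "incseq (\<lambda>N \<omega>. ennreal (R N \<omega>) * ennreal (w \<omega>))"
      by (auto simp: incseq_def le_fun_def R_def intro!: mult_right_mono ennreal_leI running_max_mono)
  qed measurable
  also have "\<dots> \<le> ennreal (16 * p' * C) * (\<integral>\<^sup>+\<omega>. S_fun p g \<omega> * weight_max M F w \<omega> \<partial>M)"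
    by (intro SUP_least finite)
  finally show ?thesis .
qed

lemma weighted_maximal_inequality:
  assumes w[measurable]: "w \<in> borel_measurable M" and w_nonneg: "\<And>\<omega>. \<omega> \<in> space M \<Longrightarrow> 0 \<le> w \<omega>"
  shows "(\<integral>\<^sup>+\<omega>. max_fun f \<omega> * ennreal (w \<omega>) \<partial>M)
    \<le> ennreal (16 * p' * C) * (\<integral>\<^sup>+\<omega>. S_fun p g \<omega> * weight_max M F w \<omega> \<partial>M)"
proof -
  define v where "v = (\<lambda>(k::nat) \<omega>. min (w \<omega>) (real k))"
  have v[measurable]: "v k \<in> borel_measurable M" for k
    unfolding v_def by measurable
  have v_le: "v k \<omega> \<le> w \<omega>" "v k \<omega> \<le> real k" for k \<omega> by (simp_all add: v_def)
  have v_nonneg: "0 \<le> v k \<omega>" if "\<omega> \<in> space M" for k \<omega>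
    using w_nonneg[OF that] by (simp add: v_def)
  have SUP_v: "(SUP k. ennreal (v k \<omega>)) = ennreal (w \<omega>)" if "\<omega> \<in> space M" for \<omega>
  proof -
    have "ennreal (v k \<omega>) = min (ennreal (w \<omega>)) (of_nat k)" for k
      using w_nonneg[OF that] by (simp add: v_def ennreal_of_nat_eq_real_of_nat min_def ennreal_le_iff)
    then show ?thesis by (simp add: ennreal_SUP_min)
  qed
  have "(\<integral>\<^sup>+\<omega>. max_fun f \<omega> * ennreal (w \<omega>) \<partial>M) = (\<integral>\<^sup>+\<omega>. (SUP k. max_fun f \<omega> * ennreal (v k \<omega>)) \<partial>M)"
    by (intro nn_integral_cong) (simp add: SUP_v flip: SUP_mult_left_ennreal)
  also have "\<dots> = (SUP k. \<integral>\<^sup>+\<omega>. max_fun f \<omega> * ennreal (v k \<omega>) \<partial>M)"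
  proof (rule nn_integral_monotone_convergence_SUP)
    show "incseq (\<lambda>k \<omega>. max_fun f \<omega> * ennreal (v k \<omega>))"
      by (auto simp: incseq_def le_fun_def v_def intro!: mult_left_mono ennreal_leI)
  qed measurable
  also have "\<dots> \<le> ennreal (16 * p' * C) * (\<integral>\<^sup>+\<omega>. S_fun p g \<omega> * weight_max M F w \<omega> \<partial>M)"
  proof (rule SUP_least)
    fix k
    have "(\<integral>\<^sup>+\<omega>. max_fun f \<omega> * ennreal (v k \<omega>) \<partial>M)
        \<le> ennreal (16 * p' * C) * (\<integral>\<^sup>+\<omega>. S_fun p g \<omega> * weight_max M F (v k) \<omega> \<partial>M)"
      by (rule weighted_maximal_bounded[OF v v_nonneg v_le(2)])
    also have "\<dots> \<le> ennreal (16 * p' * C) * (\<integral>\<^sup>+\<omega>. S_fun p g \<omega> * weight_max M F w \<omega> \<partial>M)"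
    proof (intro mult_left_mono nn_integral_mono_AE)
      show "AE \<omega> in M. S_fun p g \<omega> * weight_max M F (v k) \<omega> \<le> S_fun p g \<omega> * weight_max M F w \<omega>"
        using weight_max_mono[of "v k" w, OF v w v_le(1)] by eventually_elim (simp add: mult_left_mono)
    qed simp
    finally show "(\<integral>\<^sup>+\<omega>. max_fun f \<omega> * ennreal (v k \<omega>) \<partial>M)
        \<le> ennreal (16 * p' * C) * (\<integral>\<^sup>+\<omega>. S_fun p g \<omega> * weight_max M F w \<omega> \<partial>M)" .
  qed
  finally show ?thesis .
qed

lemma weight_max_L_bound:
  assumes w[measurable]: "w \<in> borel_measurable M"
    and w_nonneg: "\<And>\<omega>. \<omega> \<in> space M \<Longrightarrow> 0 \<le> w \<omega>" and w_le: "\<And>\<omega>. \<omega> \<in> space M \<Longrightarrow> w \<omega> \<le> k"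
    and q: "1 < q" "1 / q + 1 / r = 1"
  shows "(\<integral>\<^sup>+\<omega>. enn_power (weight_max M F w \<omega>) q \<partial>M) \<le> ennreal (r powr q * (\<integral>\<omega>. w \<omega> powr q \<partial>M))"
proof -
  obtain W where bw: "bounded_weight M F w W k"
    and W: "\<And>n. AE \<omega> in M. ennreal (W n \<omega>) = nn_cond_exp M (F n) (\<lambda>\<omega>. ennreal (w \<omega>)) \<omega>"
    by (rule bounded_weight_cond_exp[OF subalg F_mono w w_nonneg w_le]) auto
  interpret bounded_weight M F w W k by (rule bw)
  have "AE \<omega> in M. \<forall>n. ennreal (W n \<omega>) = nn_cond_exp M (F n) (\<lambda>\<omega>. ennreal (w \<omega>)) \<omega>"
    unfolding AE_all_countable using W by blast
  then have "AE \<omega> in M. enn_power (weight_max M F w \<omega>) q = (SUP n. ennreal (running_max W n \<omega> powr q))"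
  proof eventually_elim
    case (elim \<omega>)
    have "weight_max M F w \<omega> = (SUP n. ennreal (running_max W n \<omega>))"
      using elim by (simp add: weight_max_def SUP_running_max W_nonneg)
    then show ?case
      using q by (simp add: enn_power_SUP enn_power_ennreal running_maxW_nonneg)
  qed
  then have "(\<integral>\<^sup>+\<omega>. enn_power (weight_max M F w \<omega>) q \<partial>M) = (\<integral>\<^sup>+\<omega>. (SUP n. ennreal (running_max W n \<omega> powr q)) \<partial>M)"
    by (rule nn_integral_cong_AE)
  also have "\<dots> = (SUP n. \<integral>\<^sup>+\<omega>. ennreal (running_max W n \<omega> powr q) \<partial>M)"
  proof (rule nn_integral_monotone_convergence_SUP)
    show "incseq (\<lambda>n \<omega>. ennreal (running_max W n \<omega> powr q))"
      using q by (auto simp: incseq_def le_fun_def intro!: ennreal_leI powr_mono2 running_max_mono running_maxW_nonneg)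
  qed measurable
  also have "\<dots> \<le> ennreal (r powr q * (\<integral>\<omega>. w \<omega> powr q \<partial>M))"
  proof (rule SUP_least)
    fix n
    have "integrable M (\<lambda>\<omega>. running_max W n \<omega> powr q)"
    proof (rule integrable_const_bound[of _ "k powr q"])
      show "AE \<omega> in M. norm (running_max W n \<omega> powr q) \<le> k powr q"
        using q running_maxW_nonneg running_maxW_le by (intro AE_I2) (simp add: powr_mono2)
    qed measurable
    then have "(\<integral>\<^sup>+\<omega>. ennreal (running_max W n \<omega> powr q) \<partial>M) = ennreal (\<integral>\<omega>. running_max W n \<omega> powr q \<partial>M)"
      by (intro nn_integral_eq_integral) auto
    also have "\<dots> \<le> ennreal (r powr q * (\<integral>\<omega>. w \<omega> powr q \<partial>M))"
      by (intro ennreal_leI Doob_running_max q)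
    finally show "(\<integral>\<^sup>+\<omega>. ennreal (running_max W n \<omega> powr q) \<partial>M) \<le> ennreal (r powr q * (\<integral>\<omega>. w \<omega> powr q \<partial>M))" .
  qed
  finally show ?thesis .
qed

text \<open>Duality: the weighted inequality is applied to the weight \<open>\<phi>^(r - 1)\<close>, where \<open>\<phi>\<close> is \<open>f\<^sup>*\<close> cut off at
  \<open>k\<close>. By Hoelder and Doob the integral \<open>I\<close> of \<open>\<phi>^r\<close> is bounded by a multiple of \<open>I powr (1 / q)\<close>. The cutoff
  makes \<open>I\<close> finite, so that one may divide.\<close>

lemma max_fun_L_bound:
  assumes r: "1 < r" and \<sigma>: "0 < \<sigma>" and S: "(\<integral>\<^sup>+\<omega>. enn_power (S_fun p g \<omega>) r \<partial>M) \<le> ennreal (\<sigma> powr r)"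
  shows "(\<integral>\<^sup>+\<omega>. enn_power (max_fun f \<omega>) r \<partial>M) \<le> ennreal ((16 * p' * C * r * \<sigma>) powr r)"
proof -
  define A where "A = 16 * p' * C"
  have A: "0 < A" using p'_gt_1 C_pos by (simp add: A_def)
  define q where "q = r / (r - 1)"
  have q: "1 < q" "1 / q + 1 / r = 1" "1 / r + 1 / q = 1" "(r - 1) * q = r" "1 / r = 1 - 1 / q"
    using r by (auto simp: q_def field_simps)
  define \<phi> where "\<phi> = (\<lambda>(k::nat) \<omega>. enn2real (min (max_fun f \<omega>) (of_nat k)))"
  have \<phi>[measurable]: "\<phi> k \<in> borel_measurable M" for k
    unfolding \<phi>_def by measurable
  have \<phi>_eq: "ennreal (\<phi> k \<omega>) = min (max_fun f \<omega>) (of_nat k)" for k \<omega>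
    unfolding \<phi>_def by (rule ennreal_enn2real) (simp add: min_less_iff_disj of_nat_less_top)
  have \<phi>_nonneg: "0 \<le> \<phi> k \<omega>" for k \<omega> by (simp add: \<phi>_def)
  have \<phi>_le: "\<phi> k \<omega> \<le> real k" for k \<omega>
  proof -
    have "ennreal (\<phi> k \<omega>) \<le> ennreal (real k)"
      unfolding \<phi>_eq ennreal_of_nat_eq_real_of_nat by simp
    then show ?thesis by (simp add: ennreal_le_iff)
  qed
  have bound: "(\<integral>\<^sup>+\<omega>. ennreal (\<phi> k \<omega> powr r) \<partial>M) \<le> ennreal ((A * r * \<sigma>) powr r)" for k
  proof -
    define w where "w = (\<lambda>\<omega>. \<phi> k \<omega> powr (r - 1))"
    have w[measurable]: "w \<in> borel_measurable M" unfolding w_def by measurable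
    have w_nonneg: "0 \<le> w \<omega>" for \<omega> by (simp add: w_def)
    have w_le: "w \<omega> \<le> real k powr (r - 1)" for \<omega>
      unfolding w_def using r \<phi>_nonneg \<phi>_le by (intro powr_mono2) auto
    define I where "I = (\<integral>\<omega>. \<phi> k \<omega> powr r \<partial>M)"
    have I_int: "integrable M (\<lambda>\<omega>. \<phi> k \<omega> powr r)"
    proof (rule integrable_const_bound[of _ "real k powr r"])
      show "AE \<omega> in M. norm (\<phi> k \<omega> powr r) \<le> real k powr r"
        using r \<phi>_nonneg \<phi>_le by (intro AE_I2) (simp add: powr_mono2)
    qed measurable
    have I_eq: "(\<integral>\<^sup>+\<omega>. ennreal (\<phi> k \<omega> powr r) \<partial>M) = ennreal I"
      unfolding I_def using I_int by (intro nn_integral_eq_integral) auto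
    have I0: "0 \<le> I" unfolding I_def by (intro integral_nonneg_AE) auto
    have wq: "(\<integral>\<omega>. w \<omega> powr q \<partial>M) = I"
      unfolding I_def w_def by (simp add: powr_powr q(4))
    show ?thesis
    proof (cases "I = 0")
      case True
      then show ?thesis by (simp add: I_eq)
    next
      case False
      then have I: "0 < I" using I0 by simp
      define \<beta> where "\<beta> = r * I powr (1 / q)"
      have \<beta>: "0 < \<beta>" "\<beta> powr q = r powr q * I"
        using r q I by (simp_all add: \<beta>_def powr_mult powr_powr)
      have "ennreal I = (\<integral>\<^sup>+\<omega>. ennreal (\<phi> k \<omega>) * ennreal (w \<omega>) \<partial>M)"
        unfolding I_eq[symmetric]
      proof (rule nn_integral_cong)
        fix \<omega>
        have "\<phi> k \<omega> powr r = \<phi> k \<omega> * w \<omega>"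
          using powr_mult_base[OF \<phi>_nonneg[of k \<omega>], of "r - 1"] by (simp add: w_def)
        then show "ennreal (\<phi> k \<omega> powr r) = ennreal (\<phi> k \<omega>) * ennreal (w \<omega>)"
          by (simp add: ennreal_mult \<phi>_nonneg w_nonneg)
      qed
      also have "\<dots> \<le> (\<integral>\<^sup>+\<omega>. max_fun f \<omega> * ennreal (w \<omega>) \<partial>M)"
        unfolding \<phi>_eq by (intro nn_integral_mono mult_right_mono) auto
      also have "\<dots> \<le> ennreal A * (\<integral>\<^sup>+\<omega>. S_fun p g \<omega> * weight_max M F w \<omega> \<partial>M)"
        unfolding A_def by (rule weighted_maximal_bounded[OF w w_nonneg w_le])
      also have "(\<integral>\<^sup>+\<omega>. S_fun p g \<omega> * weight_max M F w \<omega> \<partial>M) \<le> ennreal (\<sigma> * \<beta>)"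
      proof (rule nn_integral_Hoelder[OF r q(1,3) \<sigma> \<beta>(1) _ _ S])
        show "(\<integral>\<^sup>+\<omega>. enn_power (weight_max M F w \<omega>) q \<partial>M) \<le> ennreal (\<beta> powr q)"
          unfolding \<beta>(2) using weight_max_L_bound[OF w w_nonneg w_le q(1,2)] by (simp add: wq)
      qed measurable
      finally have "ennreal I \<le> ennreal A * ennreal (\<sigma> * \<beta>)"
        by (simp add: mult_left_mono)
      then have "ennreal I \<le> ennreal (A * (\<sigma> * \<beta>))"
        using A \<sigma> \<beta> by (simp add: ennreal_mult)
      then have "I \<le> A * (\<sigma> * \<beta>)"
        using A \<sigma> \<beta> by (subst (asm) ennreal_le_iff) auto
      then have "I \<le> A * r * \<sigma> * I powr (1 / q)" by (simp add: \<beta>_def ac_simps)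
      moreover have "I = I powr (1 / r) * I powr (1 / q)"
        using I q by (simp flip: powr_add)
      ultimately have "I powr (1 / r) * I powr (1 / q) \<le> A * r * \<sigma> * I powr (1 / q)"
        by simp
      then have "I powr (1 / r) \<le> A * r * \<sigma>" using I by simp
      then have "(I powr (1 / r)) powr r \<le> (A * r * \<sigma>) powr r"
        using r by (intro powr_mono2) auto
      then have "I \<le> (A * r * \<sigma>) powr r" using I r by (simp add: powr_powr)
      then show ?thesis unfolding I_eq by (rule ennreal_leI)
    qed
  qed
  have "(\<integral>\<^sup>+\<omega>. enn_power (max_fun f \<omega>) r \<partial>M) = (\<integral>\<^sup>+\<omega>. (SUP k. ennreal (\<phi> k \<omega> powr r)) \<partial>M)"
  proof (rule nn_integral_cong)
    fix \<omega>
    have "enn_power (max_fun f \<omega>) r = enn_power (SUP k. ennreal (\<phi> k \<omega>)) r"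
      unfolding \<phi>_eq ennreal_SUP_min ..
    also have "\<dots> = (SUP k. ennreal (\<phi> k \<omega> powr r))"
      using r by (simp add: enn_power_SUP enn_power_ennreal \<phi>_nonneg)
    finally show "enn_power (max_fun f \<omega>) r = (SUP k. ennreal (\<phi> k \<omega> powr r))" .
  qed
  also have "\<dots> = (SUP k. \<integral>\<^sup>+\<omega>. ennreal (\<phi> k \<omega> powr r) \<partial>M)"
  proof (rule nn_integral_monotone_convergence_SUP)
    have "\<phi> i \<omega> \<le> \<phi> j \<omega>" if "i \<le> j" for i j \<omega>
    proof -
      have "ennreal (\<phi> i \<omega>) \<le> ennreal (\<phi> j \<omega>)"
        unfolding \<phi>_eq using that by (intro min.mono) auto
      then show ?thesis by (simp add: ennreal_le_iff \<phi>_nonneg)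
    qed
    then show "incseq (\<lambda>k \<omega>. ennreal (\<phi> k \<omega> powr r))"
      using r by (auto simp: incseq_def le_fun_def intro!: ennreal_leI powr_mono2 \<phi>_nonneg)
  qed measurable
  also have "\<dots> \<le> ennreal ((A * r * \<sigma>) powr r)"
    by (intro SUP_least bound)
  finally show ?thesis by (simp add: A_def)
qed

text \<open>The bound \<open>\<sigma>\<close> of the previous lemma has to be positive, hence the norm of \<open>S_fun p g\<close> is approached from
  above. For \<open>r = 1\<close>, where Doob's inequality fails, the weight \<open>1\<close> gives the claim at once.\<close>

lemma L_norm_bound:
  assumes r: "1 \<le> r"
  shows "L_norm M r (max_fun f) \<le> ennreal (16 * p' * C * r) * L_norm M r (S_fun p g)"
proof (cases "r = 1")
  case True
  have "AE \<omega> in M. weight_max M F (\<lambda>_. 1) \<omega> = 1"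
  proof -
    have "AE \<omega> in M. \<forall>n. 1 = nn_cond_exp M (F n) (\<lambda>\<omega>. ennreal 1) \<omega>"
      unfolding AE_all_countable
    proof
      fix n
      interpret sub: finite_measure_subalgebra M "F n" by unfold_locales (rule subalg)
      show "AE \<omega> in M. 1 = nn_cond_exp M (F n) (\<lambda>\<omega>. ennreal 1) \<omega>"
        using sub.nn_cond_exp_F_meas[of "\<lambda>_. ennreal 1"] by simp
    qed
    then show ?thesis by eventually_elim (simp add: weight_max_def)
  qed
  then have "AE \<omega> in M. S_fun p g \<omega> * weight_max M F (\<lambda>_. 1) \<omega> = S_fun p g \<omega>"
    by eventually_elim simp
  then have "(\<integral>\<^sup>+\<omega>. S_fun p g \<omega> * weight_max M F (\<lambda>_. 1) \<omega> \<partial>M) = (\<integral>\<^sup>+\<omega>. S_fun p g \<omega> \<partial>M)"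
    by (rule nn_integral_cong_AE)
  then show ?thesis
    using weighted_maximal_bounded[of "\<lambda>_. 1" 1] True by (simp add: L_norm_def)
next
  case False
  then have r1: "1 < r" using r by simp
  define A where "A = 16 * p' * C"
  have A: "0 < A" using p'_gt_1 C_pos by (simp add: A_def)
  show ?thesis
  proof (cases "L_norm M r (S_fun p g)")
    case top
    then show ?thesis
      using p'_gt_1 C_pos r1 by (simp add: ennreal_mult_top)
  next
    case (real s)
    have S: "(\<integral>\<^sup>+\<omega>. enn_power (S_fun p g \<omega>) r \<partial>M) = ennreal (s powr r)"
    proof -
      have "(\<integral>\<^sup>+\<omega>. enn_power (S_fun p g \<omega>) r \<partial>M) = enn_power (L_norm M r (S_fun p g)) r"
        using r1 by (simp add: L_norm_def enn_power_inverse)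
      then show ?thesis using real by (simp add: enn_power_ennreal)
    qed
    have "L_norm M r (max_fun f) \<le> ennreal (A * r * s)"
    proof (rule ennreal_le_epsilon)
      fix e :: real assume e: "0 < e"
      define \<sigma> where "\<sigma> = s + e / (A * r)"
      have \<sigma>: "0 < \<sigma>" "s \<le> \<sigma>" "A * r * \<sigma> = A * r * s + e"
        using e A r1 real by (auto simp: \<sigma>_def distrib_left intro!: add_nonneg_pos)
      have "(\<integral>\<^sup>+\<omega>. enn_power (S_fun p g \<omega>) r \<partial>M) \<le> ennreal (\<sigma> powr r)"
        unfolding S using \<sigma> real r1 by (intro ennreal_leI powr_mono2) auto
      from max_fun_L_bound[OF r1 \<sigma>(1) this]
      have "L_norm M r (max_fun f) \<le> enn_power (ennreal ((A * r * \<sigma>) powr r)) (1 / r)"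
        unfolding L_norm_def A_def using r1 by (intro enn_power_mono) auto
      also have "\<dots> = ennreal (A * r * \<sigma>)"
      proof -
        have "0 < A * r * \<sigma>" using A r1 \<sigma>(1) by simp
        then show ?thesis using r1 by (simp add: enn_power_ennreal powr_powr)
      qed
      also have "\<dots> = ennreal (A * r * s) + ennreal e"
        unfolding \<sigma>(3) using A r1 real e by (intro ennreal_plus) auto
      finally show "L_norm M r (max_fun f) \<le> ennreal (A * r * s) + ennreal e" .
    qed
    also have "\<dots> = ennreal (A * r) * ennreal s"
      using A r1 real by (intro ennreal_mult) auto
    finally show ?thesis using real by (simp add: A_def)
  qed
qed

end

theorem mainTheorem2:
  fixes M :: "'w measure"
    and F :: "nat \<Rightarrow> 'w measure"
    and g f f' :: "nat \<Rightarrow> 'w \<Rightarrow> 'x::banach"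
    and p p' C :: real
  assumes "1 < p" and "p \<le> 2" and "1 / p + 1 / p' = 1"
    and "smooth_banach TYPE('x) p C"
    and "prob_space M"
    and "filtration (space M) F"
    and "\<And>n. subalgebra M (F n)"
    and "adapted F g" and "adapted F f" and "adapted F f'"
    and "banach_martingale M F g"
    and "AE \<omega> in M. f 0 \<omega> = 0" and "AE \<omega> in M. f' 0 \<omega> = 0"
    and "\<And>n. 0 < n \<Longrightarrow> AE \<omega> in M. f n \<omega> = f' (n - 1) \<omega> + (g n \<omega> - g (n - 1) \<omega>)"
    and "\<And>n. 0 < n \<Longrightarrow> AE \<omega> in M. norm (f' n \<omega>) \<le> norm (f n \<omega>)"
  shows "(\<forall>w \<in> borel_measurable M. (\<forall>\<omega>\<in>space M. 0 \<le> w \<omega>) \<longrightarrow>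
            (\<integral>\<^sup>+\<omega>. max_fun f \<omega> * ennreal (w \<omega>) \<partial>M)
              \<le> ennreal (84 * p' * C) * (\<integral>\<^sup>+\<omega>. S_fun p g \<omega> * weight_max M F w \<omega> \<partial>M))
       \<and> (\<forall>r\<ge>1. L_norm M r (max_fun f) \<le> ennreal (84 * p' * C * r) * L_norm M r (S_fun p g))"
proof -
  interpret contractive_recursion M F g f f' p p' C
  proof (intro contractive_recursion.intro contractive_recursion_axioms.intro)
    show "sets (F m) \<subseteq> sets (F n)" if "m \<le> n" for m n
      by (rule filtration.sets_F_mono[OF assms(6) that])
    show "AE \<omega> in M. f (Suc n) \<omega> = f' n \<omega> + (g (Suc n) \<omega> - g n \<omega>)" for n
      using assms(14)[of "Suc n"] by simp
    show "AE \<omega> in M. norm (f' n \<omega>) \<le> norm (f n \<omega>)" for n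
    proof (cases "n = 0")
      case True
      show ?thesis using assms(13) by eventually_elim (simp add: True)
    next
      case False
      then show ?thesis using assms(15)[of n] by simp
    qed
  qed (fact assms)+
  have c: "ennreal (16 * p' * C) \<le> ennreal (84 * p' * C)"
    using p'_gt_1 C_pos by (intro ennreal_leI mult_right_mono) auto
  have cr: "ennreal (16 * p' * C * r) \<le> ennreal (84 * p' * C * r)" if "1 \<le> r" for r
    using p'_gt_1 C_pos that by (intro ennreal_leI mult_right_mono) auto
  show ?thesis
  proof (intro conjI ballI allI impI)
    fix w :: "'w \<Rightarrow> real"
    assume w: "w \<in> borel_measurable M" "\<forall>\<omega>\<in>space M. 0 \<le> w \<omega>"
    show "(\<integral>\<^sup>+\<omega>. max_fun f \<omega> * ennreal (w \<omega>) \<partial>M)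
        \<le> ennreal (84 * p' * C) * (\<integral>\<^sup>+\<omega>. S_fun p g \<omega> * weight_max M F w \<omega> \<partial>M)"
      by (rule order_trans[OF weighted_maximal_inequality[OF w(1)] mult_right_mono[OF c]]) (use w(2) in auto)
  next
    fix r :: real assume r: "1 \<le> r"
    show "L_norm M r (max_fun f) \<le> ennreal (84 * p' * C * r) * L_norm M r (S_fun p g)"
      by (rule order_trans[OF L_norm_bound[OF r] mult_right_mono[OF cr[OF r]]]) simp
  qed
qed

end
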